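(* Let $p>2$ be a prime, let $G$ be a finite $p$-group of nilpotency class at most $6$, and let $d$ be the largest integer such that $\exp(\gamma_d(G))=\exp(G)$. Then $G$ is a $J$-group and $\mathcal{B}(\gamma_d(G))\subseteq\mathcal{W}(G)$.
   Context: A group $G$ is a $J$-group if there exist an element $k\in G$ and a function $f\colon G\to G$ with $f(xk)=xf(x)$ for all $x\in G$. An element $k\in G$ of finite order $n=|k|$ is a witness for $G$ if $\prod_{i=1}^{n} xk^{n-i}=1$ for all $x\in G$, where the product is taken in order of increasing $i$ from left to right, i.e. it equals $xk^{n-1}xk^{n-2}\cdots xk^2\,xk\,x$. $\mathcal{W}(G)$ denotes the set of all witnesses for $G$. The exponent is $\exp(G)=\mathrm{lcm}\{|g| : g\in G\}$, and $\mathcal{B}(G)=\{x\in G : |x|=\exp(G)\}$ (for a subgroup $H$, $\mathcal{B}(H)$ is defined with respect to $\exp(H)$). The lower central series is $\gamma_1(G)=G$, $\gamma_{i+1}(G)=[\gamma_i(G),G]$; the nilpotency class is the least $c\ge 0$ with $\gamma_{c+1}(G)=1$. If $G$ is trivial, so that no largest $d$ exists, $d$ is taken to be $1$. *)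

theory Defs
  imports
    "HOL-Algebra.Generated_Groups"
    "HOL-Algebra.Multiplicative_Group"
    "HOL-Computational_Algebra.Primes"
    "HOL-Library.Extended_Nat"
begin

definition J_group :: "('a, 'b) monoid_scheme \<Rightarrow> bool" where
  "J_group G \<longleftrightarrow> group G \<and>
     (\<exists>k \<in> carrier G. \<exists>f \<in> carrier G \<rightarrow> carrier G.
        \<forall>x \<in> carrier G. f (x \<otimes>\<^bsub>G\<^esub> k) = x \<otimes>\<^bsub>G\<^esub> f x)"

text \<open>The factors \<open>x k^(n-1), \<dots>, x k, x\<close> are multiplied in this order, with \<open>n\<close> the order
  of \<open>k\<close>. In the library an element of infinite order has order 0.\<close>

definition witnesses :: "('a, 'b) monoid_scheme \<Rightarrow> 'a set" where
  "witnesses G = {k \<in> carrier G. group.ord G k > 0 \<and>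
     (\<forall>x \<in> carrier G.
        foldr (\<otimes>\<^bsub>G\<^esub>)
          (map (\<lambda>i. x \<otimes>\<^bsub>G\<^esub> k [^]\<^bsub>G\<^esub> (group.ord G k - i)) [1..<Suc (group.ord G k)]) \<one>\<^bsub>G\<^esub>
        = \<one>\<^bsub>G\<^esub>)}"

definition group_exponent :: "('a, 'b) monoid_scheme \<Rightarrow> nat" where
  "group_exponent G = Lcm (group.ord G ` carrier G)"

definition full_order_elements :: "('a, 'b) monoid_scheme \<Rightarrow> 'a set" where
  "full_order_elements G = {x \<in> carrier G. group.ord G x = group_exponent G}"

text \<open>Commutators follow the convention of the library's \<^const>\<open>derived\<close>. For subgroups
  \<open>H\<close> and \<open>K\<close>, the convention \<open>inv h inv k h k\<close> gives the same subgroup.\<close>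

definition commutator_subgroup :: "('a, 'b) monoid_scheme \<Rightarrow> 'a set \<Rightarrow> 'a set \<Rightarrow> 'a set" where
  "commutator_subgroup G H K =
     generate G (\<Union>h \<in> H. \<Union>k \<in> K. {h \<otimes>\<^bsub>G\<^esub> k \<otimes>\<^bsub>G\<^esub> inv\<^bsub>G\<^esub> h \<otimes>\<^bsub>G\<^esub> inv\<^bsub>G\<^esub> k})"

text \<open>Indexing starts at 1; the value at index 0 is a junk value.\<close>

definition lower_central :: "('a, 'b) monoid_scheme \<Rightarrow> nat \<Rightarrow> 'a set" where
  "lower_central G i = ((\<lambda>H. commutator_subgroup G H (carrier G)) ^^ (i - 1)) (carrier G)"

text \<open>The infimum is \<open>\<infinity>\<close> exactly when the group is not nilpotent.\<close>

definition nilpotency_class :: "('a, 'b) monoid_scheme \<Rightarrow> enat" where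
  "nilpotency_class G = (INF c \<in> {c. lower_central G (Suc c) = {\<one>\<^bsub>G\<^esub>}}. enat c)"

text \<open>The greatest index exists if \<open>G\<close> is nilpotent and nontrivial;
  in the trivial group all indices qualify,
  and the value is 1 by convention.\<close>

definition last_full_exponent_index :: "('a, 'b) monoid_scheme \<Rightarrow> nat" where
  "last_full_exponent_index G =
     (if carrier G = {\<one>\<^bsub>G\<^esub>} then 1
      else (GREATEST d. 1 \<le> d \<and>
              group_exponent (G\<lparr>carrier := lower_central G d\<rparr>) = group_exponent G))"

end

theory Submission
  imports Defs
begin

text \<open>
  Fix \<open>x\<close> in \<open>G\<close> and \<open>k\<close> in \<open>\<gamma>\<^sub>d\<close> of order \<open>n = p^e = exp(G)\<close>, and put
  \<open>Q(N) = x k^(N-1) \<dots> x k x\<close>, a product with \<open>N\<close> factors \<open>x k^i\<close>. The witness condition for \<open>k\<close>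
  is \<open>Q(n) = 1\<close>.

  Since \<open>Q(N+1) Q(N)^(-1) = x k^N\<close>, the sequence \<open>Q\<close> is polynomial in the sense of Lazard and
  Leibman: its iterated multiplicative differences lie deeper and deeper in a filtration \<open>H\<close> with
  \<open>[H_i, H_j] \<subseteq> H_(i+j)\<close>. Polynomial sequences form a group (\<open>Poly_filtration\<close>), and hence
  they have Taylor expansions \<open>c_0 c_1^(N choose 1) c_2^(N choose 2) \<dots>\<close> with \<open>c_r\<close> in \<open>H_r\<close>
  (\<open>taylor_coeff_in_H\<close>).

  Let \<open>L_1\<close> be generated by \<open>x\<close> and \<open>\<gamma>\<^sub>d\<close>, and \<open>L_i = \<gamma>_(d+i-1)\<close> for \<open>i \<ge> 2\<close>. This is a
  filtration (\<open>central_filtration\<close>), \<open>L_7 = 1\<close> because the class is at most 6, and \<open>p^(e-1)\<close> kills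
  \<open>L_2 = \<gamma>_(d+1)\<close> because \<open>d\<close> is maximal. Giving \<open>x\<close> the weight 1 and \<open>k\<close> the weight 2 amounts to
  taking for \<open>H_r\<close> the term of \<open>L\<close> with index \<open>r/2\<close> rounded up. So \<open>c_r = 1\<close> for \<open>r \<ge> 13\<close>, and
  \<open>p^(e-1)\<close> kills \<open>c_r\<close> for \<open>r \<ge> 3\<close>. The binomial coefficient of \<open>p^e\<close> over \<open>r\<close> is divisible by
  \<open>p^(e-v)\<close>, where \<open>p^v\<close> is the exact power of \<open>p\<close> in \<open>r\<close>. As \<open>p\<close> is odd, every factor of the
  expansion of \<open>Q(p^e)\<close> is trivial, with one possible exception: \<open>p = 3\<close> and \<open>r = 9\<close>.

  In that case it must be shown that already \<open>3^(e-2)\<close> kills \<open>c_9\<close>. The cubes of elements of \<open>L_2\<close>,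
  multiplied by the elements of \<open>L_6\<close> that \<open>3^(e-2)\<close> kills, form a normal subgroup \<open>T\<close> that is
  killed by \<open>3^(e-2)\<close> (\<open>cubes_times_torsion_normal\<close>, \<open>cubes_times_torsion_pow\<close>). Modulo \<open>T\<close> the
  group \<open>L_2\<close> has exponent 3, so the terms of the expansion of \<open>Q(9)\<close> for \<open>r\<close> between 3 and 8
  vanish, and \<open>c_9\<close> is congruent to the quotient of \<open>Q(9)\<close> by \<open>x^9 (x^(-1) k x)^36\<close>. A computation
  in groups in which \<open>L_2\<close> has exponent 3 shows that this quotient is trivial (\<open>step_product_9\<close>), so
  that \<open>c_9\<close> lies in \<open>T\<close> (\<open>ninth_coefficient\<close>).

  Finally, \<open>\<gamma>\<^sub>d\<close> contains an element of order \<open>exp(G)\<close>, and a witness \<open>k\<close> turns \<open>G\<close> into a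
  \<open>J\<close>-group: on a coset of \<open>\<langle>k\<rangle>\<close> with representative \<open>r\<close>, the prescription
  \<open>f(r k^i) = r k^(i-1) \<dots> r k r\<close> satisfies \<open>f(x k) = x f(x)\<close>, and it is consistent precisely because
  the product over a full period is 1.
\<close>

section \<open>Commutators\<close>

definition commutator :: "('a, 'b) monoid_scheme \<Rightarrow> 'a \<Rightarrow> 'a \<Rightarrow> 'a" where
  "commutator G a b = a \<otimes>\<^bsub>G\<^esub> b \<otimes>\<^bsub>G\<^esub> inv\<^bsub>G\<^esub> a \<otimes>\<^bsub>G\<^esub> inv\<^bsub>G\<^esub> b"

context group begin

lemma cancel_inv_left [simp]:
  assumes "a \<in> carrier G" "b \<in> carrier G"
  shows "inv a \<otimes> (a \<otimes> b) = b" "a \<otimes> (inv a \<otimes> b) = b"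
  using assms by (simp_all flip: m_assoc)

lemma commutator_closed [simp]:
  "\<lbrakk>a \<in> carrier G; b \<in> carrier G\<rbrakk> \<Longrightarrow> commutator G a b \<in> carrier G"
  by (simp add: commutator_def)

lemma conjugate_eq_commutator:
  "\<lbrakk>a \<in> carrier G; b \<in> carrier G\<rbrakk> \<Longrightarrow> a \<otimes> b \<otimes> inv a = commutator G a b \<otimes> b"
  by (simp add: commutator_def m_assoc)

lemma inv_commutator:
  "\<lbrakk>a \<in> carrier G; b \<in> carrier G\<rbrakk> \<Longrightarrow> inv (commutator G a b) = commutator G b a"
  by (simp add: commutator_def m_assoc inv_mult_group)

text \<open>
  How \<open>[g, h]\<close> changes when \<open>g\<close> and \<open>h\<close> are multiplied by deeper elements \<open>\<alpha>\<close> and \<open>\<beta>\<close>. On the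
  right, every factor is a commutator with \<open>\<alpha>\<close>, \<open>\<beta>\<close> or \<open>\<alpha>\<beta>\<close>, up to conjugation. The two inductions on
  commutator depth below, for polynomial sequences and for the lower central series, both rest on this
  identity, which takes the place of the Hall-Witt identity.
\<close>

lemma commutator_mult_mult:
  assumes "\<alpha> \<in> carrier G" "\<beta> \<in> carrier G" "g \<in> carrier G" "h \<in> carrier G"
  shows "commutator G (\<alpha> \<otimes> g) (\<beta> \<otimes> h) \<otimes> inv (commutator G g h) =
    (\<alpha> \<otimes> commutator G g \<beta> \<otimes> inv \<alpha>)
    \<otimes> (commutator G (\<alpha> \<otimes> \<beta>) (commutator G g h)
    \<otimes> (commutator G g h \<otimes> commutator G \<alpha> (\<beta> \<otimes> h) \<otimes> inv (commutator G g h)))"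
  using assms by (simp add: commutator_def m_assoc inv_mult_group)

end

section \<open>Filtrations and polynomial sequences\<close>

text \<open>
  \<open>H 0\<close> may be smaller than the carrier. This is essential later: the subgroup generated by
  \<open>x\<close> and \<open>\<gamma>\<^sub>d\<close> is the first term of a filtration, and in general it is not normal in \<open>G\<close>.
\<close>

locale group_filtration = group G for G (structure) +
  fixes H :: "nat \<Rightarrow> 'a set"
  assumes subgroup_H: "subgroup (H i) G"
    and H_antimono: "i \<le> j \<Longrightarrow> H j \<subseteq> H i"
    and commutator_H: "\<lbrakk>a \<in> H i; b \<in> H j\<rbrakk> \<Longrightarrow> commutator G a b \<in> H (i + j)"
begin

lemma H_closed [simp, intro]: "a \<in> H i \<Longrightarrow> a \<in> carrier G"
  using subgroup.mem_carrier[OF subgroup_H] .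

lemma H_one [simp, intro]: "\<one> \<in> H i"
  by (rule subgroup.one_closed[OF subgroup_H])

lemma H_mult [simp, intro]: "\<lbrakk>a \<in> H i; b \<in> H i\<rbrakk> \<Longrightarrow> a \<otimes> b \<in> H i"
  by (rule subgroup.m_closed[OF subgroup_H])

lemma H_inv [simp, intro]: "a \<in> H i \<Longrightarrow> inv a \<in> H i"
  by (rule subgroup.m_inv_closed[OF subgroup_H])

lemma H_pow [simp, intro]: "a \<in> H i \<Longrightarrow> a [^] (n::nat) \<in> H i"
  by (induction n) auto

lemma H_mono: "\<lbrakk>a \<in> H j; i \<le> j\<rbrakk> \<Longrightarrow> a \<in> H i"
  using H_antimono by blast

lemma commutator_H_le: "\<lbrakk>a \<in> H i; b \<in> H j; l \<le> i + j\<rbrakk> \<Longrightarrow> commutator G a b \<in> H l"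
  using commutator_H H_mono by blast

lemma conjugate_H:
  assumes "a \<in> H i" "b \<in> H j"
  shows "a \<otimes> b \<otimes> inv a \<in> H j"
proof -
  have "commutator G a b \<in> H j"
    by (rule commutator_H_le[OF assms]) simp
  thus ?thesis
    using assms by (auto simp: conjugate_eq_commutator)
qed

lemma conjugate_inv_H:
  assumes "a \<in> H i" "b \<in> H j"
  shows "inv a \<otimes> b \<otimes> a \<in> H j"
  using conjugate_H[of "inv a" i b j] assms by simp

text \<open>
  The engine of the Lazard-Leibman theorem. For an endomorphism \<open>S\<close> that respects a filtration, the
  elements that \<open>S\<close> moves only by something one step deeper form a filtration again. Products are
  controlled by \<open>S(ab) (ab)^(-1) = (S(a) S(b) b^(-1) S(a)^(-1)) (S(a) a^(-1))\<close>, and commutators by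
  \<open>commutator_mult_mult\<close>. Applied repeatedly to sequences, with the shift for \<open>S\<close>, it
  bounds one more difference each time.
\<close>

theorem difference_filtration:
  assumes S_hom: "S \<in> hom G G" and S_H: "\<And>i a. a \<in> H i \<Longrightarrow> S a \<in> H i"
  shows "group_filtration G (\<lambda>i. {a \<in> H i. S a \<otimes> inv a \<in> H (Suc i)})"
proof -
  interpret S: group_hom G G S
    by unfold_locales (rule S_hom)
  show ?thesis
  proof (unfold_locales, unfold_locales)
    fix i
    let ?D = "{a \<in> H i. S a \<otimes> inv a \<in> H (Suc i)}"
    show "?D \<subseteq> carrier G" by auto
    show "\<one> \<in> ?D" by simp
    {
      fix a b assume a: "a \<in> ?D" and b: "b \<in> ?D"
      then have ab: "a \<in> carrier G" "b \<in> carrier G" by auto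
      have "S a \<otimes> (S b \<otimes> inv b) \<otimes> inv (S a) \<in> H (Suc i)"
        using a b by (intro conjugate_H[of _ i] S_H) auto
      hence "(S a \<otimes> (S b \<otimes> inv b) \<otimes> inv (S a)) \<otimes> (S a \<otimes> inv a) \<in> H (Suc i)" (is "?e \<in> _")
        using a by auto
      moreover have "?e = S (a \<otimes> b) \<otimes> inv (a \<otimes> b)"
        using ab by (simp add: m_assoc inv_mult_group)
      ultimately show "a \<otimes> b \<in> ?D"
        using a b by simp
    next
      fix a assume a: "a \<in> ?D"
      then have a': "a \<in> carrier G" by auto
      have "inv (S a) \<otimes> inv (S a \<otimes> inv a) \<otimes> S a \<in> H (Suc i)" (is "?e \<in> _")
        using a by (intro conjugate_inv_H[of _ i] S_H) auto
      moreover have "?e = S (inv a) \<otimes> inv (inv a)"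
        using a' by (simp add: m_assoc inv_mult_group)
      ultimately show "inv a \<in> ?D"
        using a by simp
    }
  next
    fix i j :: nat assume "i \<le> j"
    then show "{a \<in> H j. S a \<otimes> inv a \<in> H (Suc j)} \<subseteq> {a \<in> H i. S a \<otimes> inv a \<in> H (Suc i)}"
      using H_antimono[of i j] H_antimono[of "Suc i" "Suc j"] by auto
  next
    fix g h i j
    assume g: "g \<in> {a \<in> H i. S a \<otimes> inv a \<in> H (Suc i)}"
      and h: "h \<in> {a \<in> H j. S a \<otimes> inv a \<in> H (Suc j)}"
    define \<alpha> \<beta> where "\<alpha> = S g \<otimes> inv g" and "\<beta> = S h \<otimes> inv h"
    have \<alpha>: "\<alpha> \<in> H (Suc i)" and \<beta>: "\<beta> \<in> H (Suc j)"
      using g h by (auto simp: \<alpha>_def \<beta>_def)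
    have gh: "g \<in> H i" "h \<in> H j" using g h by auto
    have Sg: "S g = \<alpha> \<otimes> g" and Sh: "S h = \<beta> \<otimes> h"
      using gh by (auto simp: \<alpha>_def \<beta>_def m_assoc)
    have X: "commutator G g h \<in> H (i + j)"
      using gh by (intro commutator_H)
    have "commutator G g \<beta> \<in> H (Suc (i + j))"
      by (rule commutator_H_le[OF gh(1) \<beta>]) simp
    hence 1: "\<alpha> \<otimes> commutator G g \<beta> \<otimes> inv \<alpha> \<in> H (Suc (i + j))"
      by (rule conjugate_H[OF \<alpha>])
    have "\<alpha> \<otimes> \<beta> \<in> H 1"
      using H_mono[OF \<alpha>, of 1] H_mono[OF \<beta>, of 1] by auto
    hence 2: "commutator G (\<alpha> \<otimes> \<beta>) (commutator G g h) \<in> H (Suc (i + j))"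
      using commutator_H[OF _ X, of "\<alpha> \<otimes> \<beta>" 1] by simp
    have "commutator G \<alpha> (\<beta> \<otimes> h) \<in> H (Suc (i + j))"
      by (rule commutator_H_le[OF \<alpha>, of _ j]) (use \<beta> gh H_mono[OF \<beta>, of j] in auto)
    hence 3: "commutator G g h \<otimes> commutator G \<alpha> (\<beta> \<otimes> h) \<otimes> inv (commutator G g h) \<in> H (Suc (i + j))"
      by (rule conjugate_H[OF X])
    have "S (commutator G g h) = commutator G (S g) (S h)"
      using gh by (simp add: commutator_def)
    hence "S (commutator G g h) \<otimes> inv (commutator G g h) \<in> H (Suc (i + j))"
      using commutator_mult_mult[of \<alpha> \<beta> g h] 1 2 3 \<alpha> \<beta> gh by (auto simp: Sg Sh)
    thus "commutator G g h \<in> {a \<in> H (i + j). S a \<otimes> inv a \<in> H (Suc (i + j))}"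
      using X by simp
  qed
qed

end

definition seq_group :: "('a, 'b) monoid_scheme \<Rightarrow> (nat \<Rightarrow> 'a) monoid" where
  "seq_group G = \<lparr>carrier = {g. \<forall>n. g n \<in> carrier G},
     monoid.mult = \<lambda>g h n. g n \<otimes>\<^bsub>G\<^esub> h n, one = \<lambda>n. \<one>\<^bsub>G\<^esub>\<rparr>"

definition difference :: "('a, 'b) monoid_scheme \<Rightarrow> (nat \<Rightarrow> 'a) \<Rightarrow> nat \<Rightarrow> 'a" where
  "difference G g n = g (Suc n) \<otimes>\<^bsub>G\<^esub> inv\<^bsub>G\<^esub> (g n)"

context group begin

lemma seq_group_simps [simp]:
  "g \<in> carrier (seq_group G) \<longleftrightarrow> (\<forall>n. g n \<in> carrier G)"
  "g \<otimes>\<^bsub>seq_group G\<^esub> h = (\<lambda>n. g n \<otimes> h n)"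
  "\<one>\<^bsub>seq_group G\<^esub> = (\<lambda>n. \<one>)"
  by (simp_all add: seq_group_def)

lemma group_seq_group: "group (seq_group G)"
proof (rule groupI)
  fix g assume g: "g \<in> carrier (seq_group G)"
  show "\<exists>h\<in>carrier (seq_group G). h \<otimes>\<^bsub>seq_group G\<^esub> g = \<one>\<^bsub>seq_group G\<^esub>"
    by (rule bexI[of _ "\<lambda>n. inv (g n)"]) (use g in auto)
qed (auto simp: m_assoc)

lemma inv_seq_group:
  assumes "\<forall>n. g n \<in> carrier G"
  shows "inv\<^bsub>seq_group G\<^esub> g = (\<lambda>n. inv (g n))"
  by (rule group.inv_equality[OF group_seq_group]) (use assms in auto)

lemma commutator_seq_group:
  assumes "\<forall>n. g n \<in> carrier G" "\<forall>n. h n \<in> carrier G"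
  shows "commutator (seq_group G) g h = (\<lambda>n. commutator G (g n) (h n))"
  using assms by (simp add: commutator_def inv_seq_group)

end

context group_filtration begin

lemma pointwise_filtration: "group_filtration (seq_group G) (\<lambda>i. {g. \<forall>n. g n \<in> H i})"
proof (rule group_filtration.intro[OF group_seq_group], unfold_locales)
  fix i
  let ?D = "{g :: nat \<Rightarrow> 'a. \<forall>n. g n \<in> H i}"
  show "?D \<subseteq> carrier (seq_group G)" using H_closed by fastforce
  show "\<one>\<^bsub>seq_group G\<^esub> \<in> ?D" by simp
  show "g \<otimes>\<^bsub>seq_group G\<^esub> h \<in> ?D" if "g \<in> ?D" "h \<in> ?D" for g h
    using that by simp
  show "inv\<^bsub>seq_group G\<^esub> g \<in> ?D" if "g \<in> ?D" for g
  proof -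
    have "inv\<^bsub>seq_group G\<^esub> g = (\<lambda>n. inv (g n))"
      using that by (intro inv_seq_group) auto
    thus ?thesis using that by simp
  qed
next
  fix i j :: nat assume "i \<le> j"
  then show "{g. \<forall>n. g n \<in> H j} \<subseteq> {g. \<forall>n. g n \<in> H i}"
    using H_antimono by blast
next
  fix g h :: "nat \<Rightarrow> 'a" and i j
  assume gh: "g \<in> {g. \<forall>n. g n \<in> H i}" "h \<in> {g. \<forall>n. g n \<in> H j}"
  then have "commutator (seq_group G) g h = (\<lambda>n. commutator G (g n) (h n))"
    by (intro commutator_seq_group) auto
  with gh show "commutator (seq_group G) g h \<in> {g. \<forall>n. g n \<in> H (i + j)}"
    by (simp add: commutator_H)
qed

definition Poly :: "nat \<Rightarrow> (nat \<Rightarrow> 'a) set" where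
  "Poly i = {g. \<forall>l n. (difference G ^^ l) g n \<in> H (i + l)}"

text \<open>
  Bounding finitely many differences gives the sets that \<open>difference_filtration\<close> produces one after
  the other.
\<close>

definition Poly_upto :: "nat \<Rightarrow> nat \<Rightarrow> (nat \<Rightarrow> 'a) set" where
  "Poly_upto k i = {g. \<forall>l\<le>k. \<forall>n. (difference G ^^ l) g n \<in> H (i + l)}"

lemma difference_shift: "(difference G ^^ l) (\<lambda>n. g (Suc n)) n = (difference G ^^ l) g (Suc n)"
proof (induction l arbitrary: n)
  case (Suc l)
  then show ?case by (simp add: difference_def)
qed simp

lemma Poly_upto_Suc:
  "Poly_upto (Suc k) i = {g \<in> Poly_upto k i. difference G g \<in> Poly_upto k (Suc i)}"
proof (intro equalityI subsetI)
  fix g assume g: "g \<in> Poly_upto (Suc k) i"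
  then show "g \<in> {g \<in> Poly_upto k i. difference G g \<in> Poly_upto k (Suc i)}"
    using g[unfolded Poly_upto_def mem_Collect_eq, rule_format, of "Suc _"]
    by (auto simp: Poly_upto_def funpow_Suc_right simp del: funpow.simps)
next
  fix g assume g: "g \<in> {g \<in> Poly_upto k i. difference G g \<in> Poly_upto k (Suc i)}"
  have "(difference G ^^ l) g n \<in> H (i + l)" if "l \<le> Suc k" for l n
  proof (cases l)
    case 0
    then show ?thesis using g by (auto simp: Poly_upto_def)
  next
    case (Suc l')
    then show ?thesis using g that
      by (auto simp: Poly_upto_def funpow_Suc_right simp del: funpow.simps)
  qed
  then show "g \<in> Poly_upto (Suc k) i" by (simp add: Poly_upto_def)
qed

lemma Poly_upto_filtration: "group_filtration (seq_group G) (Poly_upto k)"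
proof (induction k)
  case 0
  have "Poly_upto 0 = (\<lambda>i. {g. \<forall>n. g n \<in> H i})"
    by (auto simp: Poly_upto_def)
  then show ?case using pointwise_filtration by simp
next
  case (Suc k)
  interpret P: group_filtration "seq_group G" "Poly_upto k" by (rule Suc.IH)
  let ?S = "\<lambda>g n. g (Suc n)"
  have "group_filtration (seq_group G) (\<lambda>i. {a \<in> Poly_upto k i.
      ?S a \<otimes>\<^bsub>seq_group G\<^esub> inv\<^bsub>seq_group G\<^esub> a \<in> Poly_upto k (Suc i)})"
    by (rule P.difference_filtration) (auto simp: hom_def Poly_upto_def difference_shift)
  also have "(\<lambda>i. {a \<in> Poly_upto k i.
      ?S a \<otimes>\<^bsub>seq_group G\<^esub> inv\<^bsub>seq_group G\<^esub> a \<in> Poly_upto k (Suc i)}) = Poly_upto (Suc k)"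
  proof (intro ext)
    fix i
    have "?S a \<otimes>\<^bsub>seq_group G\<^esub> inv\<^bsub>seq_group G\<^esub> a = difference G a" if "a \<in> Poly_upto k i" for a
    proof -
      have "\<forall>n. a n \<in> carrier G"
        using P.H_closed[OF that] by simp
      thus ?thesis
        using that by (simp add: inv_seq_group difference_def fun_eq_iff)
    qed
    thus "{a \<in> Poly_upto k i.
      ?S a \<otimes>\<^bsub>seq_group G\<^esub> inv\<^bsub>seq_group G\<^esub> a \<in> Poly_upto k (Suc i)} = Poly_upto (Suc k) i"
      by (auto simp: Poly_upto_Suc simp del: seq_group_simps)
  qed
  finally show ?case .
qed

lemma Poly_eq_INT: "Poly i = (\<Inter>k. Poly_upto k i)"
  by (auto simp: Poly_def Poly_upto_def)

text \<open>
  The theorem of Lazard and Leibman, in particular closure of polynomial sequences under pointwise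
  products: it is inherited by the intersection of the filtrations \<open>Poly_upto k\<close>.
\<close>

theorem Poly_filtration: "group_filtration (seq_group G) Poly"
proof -
  note P = Poly_upto_filtration
  show ?thesis
  proof (rule group_filtration.intro[OF group_seq_group], unfold_locales)
    fix i
    show "Poly i \<subseteq> carrier (seq_group G)"
      using group_filtration.H_closed[OF P] unfolding Poly_eq_INT by blast
    show "\<one>\<^bsub>seq_group G\<^esub> \<in> Poly i"
      using group_filtration.H_one[OF P] by (auto simp: Poly_eq_INT simp del: seq_group_simps)
    show "g \<otimes>\<^bsub>seq_group G\<^esub> h \<in> Poly i" if "g \<in> Poly i" "h \<in> Poly i" for g h
      using that group_filtration.H_mult[OF P]
      by (auto simp: Poly_eq_INT simp del: seq_group_simps)
    show "inv\<^bsub>seq_group G\<^esub> g \<in> Poly i" if "g \<in> Poly i" for g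
      using that group_filtration.H_inv[OF P]
      by (auto simp: Poly_eq_INT simp del: seq_group_simps)
  next
    fix i j :: nat assume "i \<le> j"
    then show "Poly j \<subseteq> Poly i"
      unfolding Poly_eq_INT by (intro INF_mono') (rule group_filtration.H_antimono[OF P])
  next
    fix g h i j assume "g \<in> Poly i" "h \<in> Poly j"
    then show "commutator (seq_group G) g h \<in> Poly (i + j)"
      using group_filtration.commutator_H[OF P] by (auto simp: Poly_eq_INT)
  qed
qed

lemma Poly_in_H: "g \<in> Poly i \<Longrightarrow> g n \<in> H i"
  unfolding Poly_def by (metis (mono_tags, lifting) add.right_neutral funpow_0 mem_Collect_eq)

lemma Poly_mult:
  "\<lbrakk>g \<in> Poly i; h \<in> Poly i\<rbrakk> \<Longrightarrow> (\<lambda>n. g n \<otimes> h n) \<in> Poly i"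
  using group_filtration.H_mult[OF Poly_filtration, of g i h] by simp

lemma Poly_inv: "g \<in> Poly i \<Longrightarrow> (\<lambda>n. inv (g n)) \<in> Poly i"
proof -
  assume g: "g \<in> Poly i"
  then have "\<forall>n. g n \<in> carrier G"
    using Poly_in_H H_closed by blast
  then show ?thesis
    using group_filtration.H_inv[OF Poly_filtration g] by (simp add: inv_seq_group)
qed

lemma PolyI:
  assumes "\<And>n. g n \<in> H i" "difference G g \<in> Poly (Suc i)"
  shows "g \<in> Poly i"
proof -
  have "(difference G ^^ l) g n \<in> H (i + l)" for l n
  proof (cases l)
    case 0
    then show ?thesis using assms by simp
  next
    case (Suc l')
    then show ?thesis using assms
      by (auto simp: Poly_def funpow_Suc_right simp del: funpow.simps)
  qed
  thus ?thesis by (simp add: Poly_def)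
qed

lemma Poly_one: "(\<lambda>n. \<one>) \<in> Poly i"
  using group_filtration.H_one[OF Poly_filtration, of i] by simp

lemma Poly_const: "u \<in> H i \<Longrightarrow> (\<lambda>n. u) \<in> Poly i"
  by (rule PolyI) (auto simp: difference_def[abs_def] Poly_one)

text \<open>
  By Pascal's rule, the difference of \<open>u^(n choose (r+1))\<close> is \<open>u^(n choose r)\<close>.
\<close>

lemma Poly_pow_binomial:
  assumes "u \<in> H (i + r)"
  shows "(\<lambda>n. u [^] (n choose r)) \<in> Poly i"
  using assms
proof (induction r arbitrary: i)
  case 0
  then show ?case by (simp add: Poly_const)
next
  case (Suc r)
  have u: "u \<in> carrier G" using Suc.prems by auto
  show ?case
  proof (rule PolyI)
    show "u [^] (n choose Suc r) \<in> H i" for n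
      using H_mono[OF Suc.prems, of i] by auto
    have "difference G (\<lambda>n. u [^] (n choose Suc r)) = (\<lambda>n. u [^] (n choose r))"
      using u by (simp add: difference_def fun_eq_iff m_assoc flip: nat_pow_mult)
    with Suc.IH[of "Suc i"] Suc.prems show "difference G (\<lambda>n. u [^] (n choose Suc r)) \<in> Poly (Suc i)"
      by simp
  qed
qed

lemma Poly_pow: "u \<in> H (Suc i) \<Longrightarrow> (\<lambda>n. u [^] n) \<in> Poly i"
  using Poly_pow_binomial[of u i 1] by simp

end

section \<open>Taylor expansions\<close>

text \<open>
  The remainder after removing the first \<open>r\<close> factors of the Taylor expansion from the left. It is 1
  at \<open>0, \<dots>, r-1\<close>, so its value at \<open>r\<close> is the next coefficient.
\<close>

primrec taylor_rem :: "('a, 'b) monoid_scheme \<Rightarrow> (nat \<Rightarrow> 'a) \<Rightarrow> nat \<Rightarrow> nat \<Rightarrow> 'a" where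
  "taylor_rem G g 0 = g"
| "taylor_rem G g (Suc r) =
     (\<lambda>n. inv\<^bsub>G\<^esub> (taylor_rem G g r r [^]\<^bsub>G\<^esub> (n choose r)) \<otimes>\<^bsub>G\<^esub> taylor_rem G g r n)"

abbreviation "taylor_coeff G g r \<equiv> taylor_rem G g r r"

context group_filtration begin

text \<open>
  If all values before \<open>r\<close> are trivial, then the \<open>r\<close>-th difference at 0 is the value at \<open>r\<close>.
\<close>

lemma Poly_first_value:
  assumes g: "g \<in> Poly 0" and zero: "\<And>n. n < r \<Longrightarrow> g n = \<one>"
  shows "g r \<in> H r"
proof -
  have "(\<forall>n. n + l < r \<longrightarrow> (difference G ^^ l) g n = \<one>) \<and> (difference G ^^ l) g (r - l) = g r" if "l \<le> r" for l
    using that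
  proof (induction l)
    case 0
    then show ?case using zero by simp
  next
    case (Suc l)
    then have IH: "\<And>n. n + l < r \<Longrightarrow> (difference G ^^ l) g n = \<one>" "(difference G ^^ l) g (r - l) = g r"
      by auto
    have "Suc (r - Suc l) = r - l" "r - Suc l + l < r"
      using Suc.prems by auto
    have "(difference G ^^ Suc l) g n = (difference G ^^ l) g (Suc n) \<otimes> inv ((difference G ^^ l) g n)" for n
      by (simp add: difference_def)
    then show ?case
      using IH H_closed[OF Poly_in_H[OF g, of r]] \<open>Suc (r - Suc l) = r - l\<close> \<open>r - Suc l + l < r\<close>
      by (simp del: funpow.simps)
  qed
  from this[of r] have "(difference G ^^ r) g 0 = g r" by simp
  moreover have "(difference G ^^ r) g 0 \<in> H (0 + r)"
    using g by (simp only: Poly_def mem_Collect_eq)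
  ultimately show ?thesis by simp
qed

lemma taylor_rem_invariant:
  assumes g: "g \<in> Poly 0"
  shows "taylor_rem G g r \<in> Poly 0 \<and> (\<forall>n<r. taylor_rem G g r n = \<one>)"
proof (induction r)
  case 0
  then show ?case using g by simp
next
  case (Suc r)
  let ?c = "taylor_rem G g r r"
  have c: "?c \<in> H r"
    by (rule Poly_first_value) (use Suc.IH in auto)
  have "(\<lambda>n. inv (?c [^] (n choose r))) \<in> Poly 0"
    using c by (intro Poly_inv Poly_pow_binomial) simp
  then have "taylor_rem G g (Suc r) \<in> Poly 0"
    using Suc.IH by (simp add: Poly_mult)
  moreover have "taylor_rem G g (Suc r) n = \<one>" if "n < Suc r" for n
  proof (cases "n = r")
    case True
    then show ?thesis using H_closed[OF c] by simp
  next
    case False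
    then show ?thesis using that Suc.IH by (simp add: binomial_eq_0)
  qed
  ultimately show ?case by (intro conjI allI impI)
qed

lemma taylor_coeff_in_H: "g \<in> Poly 0 \<Longrightarrow> taylor_coeff G g r \<in> H r"
  using taylor_rem_invariant[of g r] by (intro Poly_first_value) auto

lemma taylor_rem_eq_one: "\<lbrakk>g \<in> Poly 0; n < r\<rbrakk> \<Longrightarrow> taylor_rem G g r n = \<one>"
  using taylor_rem_invariant[of g r] by auto

text \<open>
  The value at \<open>n\<close> is the product of the factors of the Taylor expansion for \<open>r \<le> n\<close>, because the
  remainder after \<open>n+1\<close> steps is trivial at \<open>n\<close>.
\<close>

lemma Poly_value_eq_one:
  assumes g: "g \<in> Poly 0"
    and terms: "\<And>r. taylor_coeff G g r [^] (n choose r) = \<one>"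
  shows "g n = \<one>"
proof -
  have "taylor_rem G g r n = g n" for r
  proof (induction r)
    case (Suc r)
    then show ?case using H_closed[OF Poly_in_H[OF g, of n]] by (simp add: terms)
  qed simp
  then show ?thesis
    using taylor_rem_eq_one[OF g, of n "Suc n"] by (simp del: taylor_rem.simps)
qed

end

section \<open>The product with nine factors when the second term has exponent 3\<close>

text \<open>
  The word \<open>x k^(n-1) \<dots> x k x\<close> of the witness condition, with the length \<open>n\<close> detached from the
  order of \<open>k\<close>, so that it becomes a sequence in \<open>n\<close>.
\<close>

primrec step_product :: "('a, 'b) monoid_scheme \<Rightarrow> 'a \<Rightarrow> 'a \<Rightarrow> nat \<Rightarrow> 'a" where
  "step_product G x k 0 = \<one>\<^bsub>G\<^esub>"
| "step_product G x k (Suc n) = x \<otimes>\<^bsub>G\<^esub> (k [^]\<^bsub>G\<^esub> n \<otimes>\<^bsub>G\<^esub> step_product G x k n)"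

context group begin

lemma step_product_closed [simp]:
  "\<lbrakk>x \<in> carrier G; k \<in> carrier G\<rbrakk> \<Longrightarrow> step_product G x k n \<in> carrier G"
  by (induction n) auto

lemma hom_step_product:
  assumes "group_hom G G' h" "x \<in> carrier G" "k \<in> carrier G"
  shows "h (step_product G x k n) = step_product G' (h x) (h k) n"
proof -
  interpret h: group_hom G G' h by fact
  show ?thesis
    using assms(2,3) by (induction n) (simp_all add: h.hom_nat_pow)
qed

text \<open>
  Turns a commutation rule into a rule that applies inside a word bracketed to the right. With
  it the simplifier collects words.
\<close>

lemma assoc_rule:
  assumes "a \<otimes> b = c" "a \<in> carrier G" "b \<in> carrier G" "y \<in> carrier G"
  shows "a \<otimes> (b \<otimes> y) = c \<otimes> y"
  using assms by (simp flip: m_assoc)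

lemma pow_3: "a \<in> carrier G \<Longrightarrow> a [^] (3::nat) = a \<otimes> (a \<otimes> a)"
  by (simp add: numeral_3_eq_3 m_assoc)

lemma conjugate_pow:
  "\<lbrakk>g \<in> carrier G; a \<in> carrier G\<rbrakk> \<Longrightarrow> (g \<otimes> a \<otimes> inv g) [^] (n::nat) = g \<otimes> a [^] n \<otimes> inv g"
  by (induction n) (simp_all add: m_assoc)

lemma cube_cancel:
  assumes "a [^] (3::nat) = \<one>" "a \<in> carrier G"
  shows "a \<otimes> (a \<otimes> a) = \<one>" "\<And>y. y \<in> carrier G \<Longrightarrow> a \<otimes> (a \<otimes> (a \<otimes> y)) = y"
  using assms by (simp_all add: pow_3 flip: m_assoc)

lemma commutator_eq_oneD:
  assumes "commutator G a b = \<one>" "a \<in> carrier G" "b \<in> carrier G"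
  shows "a \<otimes> b = b \<otimes> a"
proof -
  have "a \<otimes> b = commutator G a b \<otimes> (b \<otimes> a)"
    using assms(2,3) by (simp add: commutator_def m_assoc)
  with assms show ?thesis by simp
qed

text \<open>
  Sorting the letters of \<open>(y d \<kappa>)^3\<close> requires three transpositions of each of the pairs
  \<open>(\<kappa>, y)\<close>, \<open>(\<kappa>, d)\<close> and \<open>(d, y)\<close>. The corrections \<open>g\<close>, \<open>m\<close>, \<open>z\<close> therefore occur as cubes, and so
  does \<open>d\<close>.
\<close>

lemma cube_collect:
  assumes cl [simp]: "y \<in> carrier G" "d \<in> carrier G" "\<kappa> \<in> carrier G"
      "g \<in> carrier G" "z \<in> carrier G" "m \<in> carrier G"
    and \<kappa>y: "\<kappa> \<otimes> y = y \<otimes> (g \<otimes> \<kappa>)" and \<kappa>d: "\<kappa> \<otimes> d = d \<otimes> (m \<otimes> \<kappa>)" and dy: "d \<otimes> y = y \<otimes> (d \<otimes> z)"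
    and yg: "y \<otimes> g = g \<otimes> y" and yz: "y \<otimes> z = z \<otimes> y" and ym: "y \<otimes> m = m \<otimes> y"
    and dg: "d \<otimes> g = g \<otimes> d" and dz: "d \<otimes> z = z \<otimes> d" and dm: "d \<otimes> m = m \<otimes> d"
    and \<kappa>g: "\<kappa> \<otimes> g = g \<otimes> \<kappa>" and \<kappa>z: "\<kappa> \<otimes> z = z \<otimes> \<kappa>" and \<kappa>m: "\<kappa> \<otimes> m = m \<otimes> \<kappa>"
    and zg: "z \<otimes> g = g \<otimes> z" and mg: "m \<otimes> g = g \<otimes> m" and mz: "m \<otimes> z = z \<otimes> m"
    and cubes: "d [^] (3::nat) = \<one>" "g [^] (3::nat) = \<one>" "z [^] (3::nat) = \<one>" "m [^] (3::nat) = \<one>"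
  shows "(y \<otimes> (d \<otimes> \<kappa>)) [^] (3::nat) = y [^] (3::nat) \<otimes> \<kappa> [^] (3::nat)"
proof -
  note rules = \<kappa>y \<kappa>d dy yg yz ym dg dz dm \<kappa>g \<kappa>z \<kappa>m zg mg mz
  note cubes' = cube_cancel[OF cubes(1)] cube_cancel[OF cubes(2)] cube_cancel[OF cubes(3)] cube_cancel[OF cubes(4)]
  show ?thesis
    by (simp add: pow_3 m_assoc rules rules[THEN assoc_rule] cubes')
qed

end

context group_filtration begin

lemma H_commute:
  assumes "H r = {\<one>}" "a \<in> H i" "b \<in> H j" "r \<le> i + j"
  shows "a \<otimes> b = b \<otimes> a"
proof -
  have "commutator G a b = \<one>"
    using commutator_H_le[OF assms(2,3,4)] assms(1) by simp
  then show ?thesis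
    using assms by (intro commutator_eq_oneD) auto
qed

lemma H_swap:
  assumes "a \<in> H i" "b \<in> H j"
  obtains c where "c \<in> H (i + j)" "a \<otimes> b = b \<otimes> (a \<otimes> c)"
proof
  have cl: "a \<in> carrier G" "b \<in> carrier G"
    using assms by auto
  show "inv a \<otimes> (inv b \<otimes> commutator G a b \<otimes> b) \<otimes> a \<in> H (i + j)"
    by (intro conjugate_inv_H[OF assms(1)] conjugate_inv_H[OF assms(2)] commutator_H assms)
  show "a \<otimes> b = b \<otimes> (a \<otimes> (inv a \<otimes> (inv b \<otimes> commutator G a b \<otimes> b) \<otimes> a))"
    using cl by (simp add: commutator_def m_assoc)
qed

text \<open>
  Cubing gains two extra steps of depth. With \<open>c = [b, a]\<close>, \<open>u = [b, c]\<close>, \<open>v = [b, u]\<close>, moving three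
  letters \<open>b\<close> past \<open>a\<close> produces \<open>v u u c u c c\<close>. Here \<open>c\<close> and \<open>u\<close> occur three times each, and they
  commute up to \<open>H (2 * i + 3)\<close>; what remains is as deep as \<open>v\<close>.
\<close>

lemma commutator_cube:
  assumes cube: "\<And>u. u \<in> H 2 \<Longrightarrow> u [^] (3::nat) = \<one>"
    and a: "a \<in> H i" and i: "1 \<le> i" and b: "b \<in> H 1"
  shows "commutator G (b [^] (3::nat)) a \<in> H (i + 3)"
proof -
  define c u v where "c = commutator G b a" and "u = commutator G b c" and "v = commutator G b u"
  have c: "c \<in> H (i + 1)" unfolding c_def by (rule commutator_H_le[OF b a]) simp
  have u: "u \<in> H (i + 2)" unfolding u_def by (rule commutator_H_le[OF b c]) simp
  have v: "v \<in> H (i + 3)" unfolding v_def by (rule commutator_H_le[OF b u]) simp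
  have cl: "a \<in> carrier G" "b \<in> carrier G" "c \<in> carrier G" "u \<in> carrier G" "v \<in> carrier G"
    using a b c u v by blast+
  have ba: "b \<otimes> a = c \<otimes> (a \<otimes> b)" and bc: "b \<otimes> c = u \<otimes> (c \<otimes> b)" and bu: "b \<otimes> u = v \<otimes> (u \<otimes> b)"
    unfolding v_def using cl by (simp_all add: c_def u_def commutator_def m_assoc inv_mult_group)
  have "b \<otimes> (b \<otimes> (b \<otimes> a)) = v \<otimes> (u \<otimes> (u \<otimes> (c \<otimes> (u \<otimes> (c \<otimes> (c \<otimes> (a \<otimes> (b \<otimes> (b \<otimes> b)))))))))"
    using cl by (simp add: m_assoc ba bc bu assoc_rule[OF ba] assoc_rule[OF bc] assoc_rule[OF bu])
  then have "commutator G (b [^] (3::nat)) a = v \<otimes> (u \<otimes> (u \<otimes> (c \<otimes> (u \<otimes> (c \<otimes> c)))))"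
    using cl by (simp add: pow_3 commutator_def m_assoc inv_mult_group)
  also have "\<dots> = v \<otimes> ((u \<otimes> u) \<otimes> commutator G c u \<otimes> inv (u \<otimes> u))"
  proof -
    have "c [^] (3::nat) = \<one>" "u [^] (3::nat) = \<one>"
      using H_mono[OF c, of 2] H_mono[OF u, of 2] i by (simp_all add: cube)
    note cubes = cube_cancel[OF this(1)] cube_cancel[OF this(2)]
    have uu: "u \<otimes> u = inv u" and cc: "c \<otimes> c = inv c"
      using cubes cl by (metis inv_equality m_assoc m_closed)+
    have "inv (u \<otimes> u) = u"
      using cl by (simp add: uu)
    then show ?thesis
      using cl by (simp add: commutator_def m_assoc cc) 
  qed
  also have "\<dots> \<in> H (i + 3)"
  proof (rule H_mult[OF v conjugate_H])
    show "u \<otimes> u \<in> H 2" using H_mono[OF u, of 2] by simp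
    show "commutator G c u \<in> H (i + 3)"
      by (rule commutator_H_le[OF c u]) simp
  qed
  finally show ?thesis .
qed

text \<open>
  Write \<open>\<kappa> = k^3\<close>. It commutes with \<open>x\<close> up to some \<open>w\<close> in \<open>H 4\<close>, by \<open>commutator_cube\<close>. Collecting
  all \<open>\<kappa>\<close> on the right leaves three blocks \<open>b = x k^2 x k x\<close> with powers of \<open>w\<close> inside.
  Collecting \<open>w\<close> behind each block makes its exponent a multiple of 3 and leaves only powers of a
  correction \<open>s\<close> in \<open>H 5\<close> with total exponent 3, which commute with \<open>b\<close>. Thus
  \<open>Q(9) = b^3 \<kappa>^9\<close>. Moreover \<open>b = x^3 d \<kappa>\<close> with \<open>d\<close> in \<open>H 2\<close>, whence \<open>b^3 = x^9 \<kappa>^3\<close> by \<open>cube_collect\<close>.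

  The element \<open>x^(-1) k x\<close> in the conclusion is the second Taylor coefficient of the sequence; its
  36th power equals \<open>k^36\<close>, since \<open>k^9\<close> commutes with \<open>x\<close>.
\<close>

lemma step_product_9:
  assumes H7: "H 7 = {\<one>}" and cube: "\<And>u. u \<in> H 2 \<Longrightarrow> u [^] (3::nat) = \<one>"
    and x: "x \<in> H 1" and k: "k \<in> H 1"
  shows "step_product G x k 9 = x [^] (9::nat) \<otimes> (inv x \<otimes> k \<otimes> x) [^] (36::nat)"
proof -
  note comm = H_commute[OF H7]
  have cube': "u [^] (3::nat) = \<one>" if "u \<in> H i" "2 \<le> i" for u i
    using cube H_mono[OF that] by blast
  define \<kappa> where "\<kappa> = k \<otimes> (k \<otimes> k)"
  define b where "b = x \<otimes> (k \<otimes> (k \<otimes> (x \<otimes> (k \<otimes> x))))"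
  have xk [simp]: "x \<in> carrier G" "k \<in> carrier G" "\<kappa> \<in> carrier G" "b \<in> carrier G"
    using x k by (auto simp: \<kappa>_def b_def)
  have \<kappa>: "\<kappa> \<in> H 1" using k by (simp add: \<kappa>_def)
  have \<kappa>3: "\<kappa> = k [^] (3::nat)" using k by (simp add: \<kappa>_def pow_3)
  have deep: "commutator G (a [^] (3::nat)) u \<in> H (i + 3)" if "a \<in> H 1" "u \<in> H i" "1 \<le> i" for a u i
    using commutator_cube[OF cube that(2,3,1)] .
  have comm3: "a [^] (3::nat) \<otimes> u = u \<otimes> a [^] (3::nat)" if "a \<in> H 1" "u \<in> H i" "4 \<le> i" for a u i
  proof -
    have "commutator G (a [^] (3::nat)) u \<in> H 7"
      using deep[OF that(1,2)] H_mono[of _ "i + 3" 7] that by simp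
    then show ?thesis
      using H7 H_closed[OF that(1)] H_closed[OF that(2)]
      by (intro commutator_eq_oneD) auto
  qed
  have sw3: "\<exists>c\<in>H (i + 3). a [^] (3::nat) \<otimes> u = u \<otimes> (c \<otimes> a [^] (3::nat))"
    if "a \<in> H 1" "u \<in> H i" "1 \<le> i" for a u i
  proof
    show "inv u \<otimes> commutator G (a [^] (3::nat)) u \<otimes> u \<in> H (i + 3)"
      by (rule conjugate_inv_H[OF that(2) deep[OF that]])
    show "a [^] (3::nat) \<otimes> u = u \<otimes> (inv u \<otimes> commutator G (a [^] (3::nat)) u \<otimes> u \<otimes> a [^] (3::nat))"
      using H_closed[OF that(1)] H_closed[OF that(2)] by (simp add: commutator_def m_assoc)
  qed
  obtain w where w: "w \<in> H 4" and \<kappa>x: "\<kappa> \<otimes> x = x \<otimes> (w \<otimes> \<kappa>)"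
    using sw3[OF k x] unfolding \<kappa>3[symmetric] by auto
  have \<kappa>w: "\<kappa> \<otimes> w = w \<otimes> \<kappa>"
    using comm3[OF k w] unfolding \<kappa>3[symmetric] by simp
  have \<kappa>k: "\<kappa> \<otimes> k = k \<otimes> \<kappa>"
    by (simp add: \<kappa>_def m_assoc)
  have kx: "k \<otimes> x \<in> H 1" using k x by simp
  obtain s where "s \<in> H (4 + 1)" and "w \<otimes> (k \<otimes> x) = (k \<otimes> x) \<otimes> (w \<otimes> s)"
    by (rule H_swap[OF w kx])
  then have s: "s \<in> H 5" and wkx: "w \<otimes> (k \<otimes> x) = k \<otimes> (x \<otimes> (w \<otimes> s))"
    using H_closed[OF w] H_closed[of s "4+1"] by (simp_all add: m_assoc)
  have ws [simp]: "w \<in> carrier G" "s \<in> carrier G" using w s by auto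
  have wkx': "w \<otimes> (k \<otimes> (x \<otimes> y)) = k \<otimes> (x \<otimes> (w \<otimes> (s \<otimes> y)))" if "y \<in> carrier G" for y
    using that wkx by (simp flip: m_assoc)
  have sw: "s \<otimes> w = w \<otimes> s" by (rule comm[OF s w]) simp
  note w3 = cube_cancel[OF cube'[OF w]] and s3 = cube_cancel[OF cube'[OF s]]
  \<comment> \<open>The last block of three factors is already written as \<open>b\<close>.\<close>
  have "step_product G x k 9 =
     x \<otimes> (k\<otimes>(k\<otimes>(\<kappa>\<otimes>(\<kappa> \<otimes> (x \<otimes> (k\<otimes>(\<kappa>\<otimes>(\<kappa> \<otimes> (x \<otimes> (\<kappa>\<otimes>(\<kappa> \<otimes>
    (x \<otimes> (k\<otimes>(k\<otimes>(\<kappa> \<otimes> (x \<otimes> (k\<otimes>(\<kappa> \<otimes> (x \<otimes> (\<kappa> \<otimes> b))))))))))))))))))))"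
    by (simp add: eval_nat_numeral m_assoc \<kappa>_def b_def)
  also have "\<dots> = b \<otimes> (s \<otimes> (s \<otimes> (b \<otimes> (s \<otimes> (b \<otimes> (\<kappa> \<otimes> (\<kappa> \<otimes> (\<kappa> \<otimes>
      (\<kappa> \<otimes> (\<kappa> \<otimes> (\<kappa> \<otimes> (\<kappa> \<otimes> (\<kappa> \<otimes> \<kappa>)))))))))))))"
    unfolding b_def
    by (simp add: m_assoc \<kappa>x \<kappa>w \<kappa>k assoc_rule[OF \<kappa>x] assoc_rule[OF \<kappa>w] assoc_rule[OF \<kappa>k] w3)
      (simp add: m_assoc wkx wkx' sw assoc_rule[OF sw] w3 s3)
  finally have Q: "step_product G x k 9 = \<dots>" .

  define y where "y = x [^] (3::nat)"
  \<comment> \<open>The factor \<open>d\<close> arises from moving the letters \<open>x\<close> of \<open>b\<close> to the left.\<close>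
  define d where "d = commutator G (inv x \<otimes> inv x) (k \<otimes> k) \<otimes>
    ((k \<otimes> k) \<otimes> commutator G (inv x) k \<otimes> inv (k \<otimes> k))"
  have y: "y \<in> H 1" using x by (simp add: y_def)
  have d: "d \<in> H 2"
    unfolding d_def using x k
    by (intro H_mult conjugate_H[of _ 1] commutator_H_le[of _ 1 _ 1]) auto
  have yd [simp]: "y \<in> carrier G" "d \<in> carrier G" using y d by auto
  have b: "b = y \<otimes> (d \<otimes> \<kappa>)"
    by (simp add: b_def y_def d_def \<kappa>_def commutator_def pow_3 m_assoc inv_mult_group)
  have ysw: "y \<otimes> s = s \<otimes> y" unfolding y_def by (rule comm3[OF x s]) simp
  have \<kappa>s: "\<kappa> \<otimes> s = s \<otimes> \<kappa>" using comm3[OF k s] by (simp add: \<kappa>3)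
  have ds: "d \<otimes> s = s \<otimes> d" by (rule comm[OF d s]) simp
  have bs: "b \<otimes> s = s \<otimes> b"
    by (simp add: b m_assoc \<kappa>s ds ysw assoc_rule[OF ds] assoc_rule[OF ysw])
  have "b [^] (3::nat) = y [^] (3::nat) \<otimes> \<kappa> [^] (3::nat)"
  proof -
    \<comment> \<open>\<open>commutator_cube\<close> only puts the correction between \<open>\<kappa>\<close> and \<open>y\<close> into \<open>H 4\<close>, which is not deep enough for it to commute with everything; computing it in terms of \<open>w\<close> puts it into \<open>H 6\<close>.\<close>
    obtain f where "f \<in> H (4 + 1)" and wx: "w \<otimes> x = x \<otimes> (w \<otimes> f)"
      by (rule H_swap[OF w x])
    then have f: "f \<in> H 5" by simp
    obtain g where "g \<in> H (5 + 1)" and fx: "f \<otimes> x = x \<otimes> (f \<otimes> g)"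
      by (rule H_swap[OF f x])
    then have g: "g \<in> H 6" by simp
    have fg [simp]: "f \<in> carrier G" "g \<in> carrier G" using f g by auto
    have fw: "f \<otimes> w = w \<otimes> f" by (rule comm[OF f w]) simp
    have gw: "g \<otimes> w = w \<otimes> g" by (rule comm[OF g w]) simp
    have gf: "g \<otimes> f = f \<otimes> g" by (rule comm[OF g f]) simp
    note f3 = cube_cancel[OF cube'[OF f]]
    have \<kappa>y: "\<kappa> \<otimes> y = y \<otimes> (g \<otimes> \<kappa>)"
      using w3 f3
      by (simp add: y_def pow_3 m_assoc \<kappa>x assoc_rule[OF \<kappa>x] \<kappa>w assoc_rule[OF \<kappa>w]
          wx assoc_rule[OF wx] fx assoc_rule[OF fx] fw assoc_rule[OF fw] gw assoc_rule[OF gw]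
          gf assoc_rule[OF gf])
    obtain m where "m \<in> H (2 + 3)" and \<kappa>d: "\<kappa> \<otimes> d = d \<otimes> (m \<otimes> \<kappa>)"
      using sw3[OF k d] unfolding \<kappa>3[symmetric] by auto
    then have m: "m \<in> H 5" by simp
    obtain z' where "z' \<in> H (2 + 3)" and yd': "y \<otimes> d = d \<otimes> (z' \<otimes> y)"
      using sw3[OF x d] unfolding y_def[symmetric] by auto
    then have z': "z' \<in> H 5" by simp
    define z where "z = inv z'"
    have z: "z \<in> H 5" using z' by (simp add: z_def)
    have mz [simp]: "m \<in> carrier G" "z \<in> carrier G" "z' \<in> carrier G" using m z z' by auto
    have yz: "y \<otimes> z = z \<otimes> y" unfolding y_def by (rule comm3[OF x z]) simp
    have "y \<otimes> (d \<otimes> z) = d \<otimes> (z' \<otimes> (y \<otimes> z))"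
      using assoc_rule[OF yd'] by (simp add: m_assoc)
    also have "\<dots> = d \<otimes> y"
      unfolding yz by (simp add: z_def)
    finally have dy: "d \<otimes> y = y \<otimes> (d \<otimes> z)" ..
    show ?thesis
      unfolding b
    proof (rule cube_collect[OF _ _ _ _ _ _ \<kappa>y \<kappa>d dy])
      show "y \<otimes> m = m \<otimes> y" unfolding y_def by (rule comm3[OF x m]) simp
      show "\<kappa> \<otimes> z = z \<otimes> \<kappa>" using comm3[OF k z] by (simp add: \<kappa>3)
      show "\<kappa> \<otimes> m = m \<otimes> \<kappa>" using comm3[OF k m] by (simp add: \<kappa>3)
    qed (use y d \<kappa> g m z yz in \<open>auto intro: comm cube'\<close>)
  qed
  then have b3: "b \<otimes> (b \<otimes> b) = y [^] (3::nat) \<otimes> \<kappa> [^] (3::nat)"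
    by (simp add: pow_3)
  have "step_product G x k 9 = (b \<otimes> (b \<otimes> b)) \<otimes> \<kappa> [^] (9::nat)"
    unfolding Q using s3 by (simp add: m_assoc bs assoc_rule[OF bs] eval_nat_numeral)
  also have "\<dots> = x [^] (9::nat) \<otimes> k [^] (36::nat)"
    unfolding b3 by (simp add: y_def \<kappa>3 nat_pow_pow m_assoc nat_pow_mult)
  also have "k [^] (36::nat) = (inv x \<otimes> k \<otimes> x) [^] (36::nat)"
  proof -
    have "\<kappa> [^] (3::nat) \<otimes> x = x \<otimes> \<kappa> [^] (3::nat)"
      by (simp add: pow_3 m_assoc \<kappa>x assoc_rule[OF \<kappa>x] \<kappa>w assoc_rule[OF \<kappa>w] w3)
    then have "(\<kappa> [^] (3::nat)) [^] (4::nat) \<otimes> x = x \<otimes> (\<kappa> [^] (3::nat)) [^] (4::nat)"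
      by (rule group_commutes_pow) simp_all
    then have "k [^] (36::nat) \<otimes> x = x \<otimes> k [^] (36::nat)"
      by (simp add: \<kappa>3 nat_pow_pow)
    then show ?thesis
      using conjugate_pow[of "inv x" k 36] by (simp add: m_assoc)
  qed
  finally show ?thesis .
qed

end

section \<open>Divisibility of binomial coefficients and powers\<close>

lemma prime_power_dvd_binomial:
  fixes p :: nat
  assumes p: "prime p" and i: "i = p ^ a * j" "\<not> p dvd j"
  shows "p ^ (e - a) dvd (p ^ e choose i)"
proof (cases "a \<le> e")
  case True
  have "0 < i" using i p by (auto simp: prime_gt_0_nat intro: Nat.gr0I)
  then have "i * (p ^ e choose i) = p ^ e * ((p ^ e - 1) choose (i - 1))"
    by (rule times_binomial_minus1_eq)
  then have "p ^ e dvd p ^ a * (j * (p ^ e choose i))"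
    by (simp add: i(1) mult.assoc)
  then have "p ^ a * p ^ (e - a) dvd p ^ a * (j * (p ^ e choose i))"
    using True by (simp flip: power_add)
  then have "p ^ (e - a) dvd j * (p ^ e choose i)"
    using p by (simp add: prime_gt_0_nat)
  moreover have "coprime (p ^ (e - a)) j"
    using p i(2) by (simp add: prime_imp_coprime)
  ultimately show ?thesis
    by (simp add: coprime_dvd_mult_right_iff)
qed simp

text \<open>
  Exactness of the power of 3 matters here: a relation that holds for the exponent
  \<open>3^(e+1) choose 3\<close> is to be sharpened to the exponent \<open>3^e\<close>.
\<close>

lemma binomial_3_power_3:
  "\<exists>t. (3 ^ Suc e choose 3) = 3 ^ e * t \<and> \<not> 3 dvd t" for e :: nat
proof (intro exI conjI)
  let ?N = "3 ^ Suc e :: nat" and ?t = "(3 ^ Suc e - 1) choose 2 :: nat"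
  have "3 * (?N choose 3) = ?N * ((?N - 1) choose (3 - 1))"
    by (rule times_binomial_minus1_eq) simp
  then show "(?N choose 3) = 3 ^ e * ?t"
    by simp
  obtain q :: nat where "3 ^ e = Suc q"
    using not0_implies_Suc[of "3 ^ e"] by auto
  then have q: "?N = 3 * Suc q"
    by simp
  have "2 * ?t = (?N - 1) * ((?N - 1 - 1) choose (2 - 1))"
    by (rule times_binomial_minus1_eq) simp
  also have "\<dots> = (?N - 1) * (?N - 2)"
    by (simp add: numeral_2_eq_2 del: power_Suc)
  also have "\<dots> = 3 * (3 * q * q + 3 * q) + 2"
    unfolding q by (simp add: algebra_simps)
  finally have t: "2 * ?t = 3 * (3 * q * q + 3 * q) + 2" .
  show "\<not> 3 dvd ?t"
  proof
    assume "3 dvd ?t"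
    then have "3 dvd 2 * ?t" by (rule dvd_mult)
    then show False unfolding t by (subst (asm) dvd_add_right_iff) auto
  qed
qed

context group begin

lemma pow_eq_one_dvd:
  "\<lbrakk>a \<in> carrier G; a [^] (m::nat) = \<one>; m dvd n\<rbrakk> \<Longrightarrow> a [^] n = \<one>"
  by (metis dvd_trans pow_eq_id)

lemma pow_eq_one_coprime:
  assumes "a \<in> carrier G" "a [^] (m * s) = \<one>" "a [^] (m * t) = \<one>" "coprime s (t :: nat)"
  shows "a [^] m = \<one>"
proof -
  have "ord a dvd gcd (m * s) (m * t)"
    using assms by (simp add: pow_eq_id)
  then show ?thesis
    using assms by (simp add: pow_eq_id gcd_mult_distrib_nat[symmetric])
qed

end

context group_filtration begin

section \<open>Cubes of elements of the second term\<close>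

text \<open>
  The \<open>i\<close>-th term of the lower central series of \<open>H 2\<close> lies in \<open>H (2 * i)\<close>. So this is the
  filtration that governs the expansion of \<open>(uv)^n\<close> for \<open>u, v\<close> in \<open>H 2\<close>.
\<close>

lemma even_filtration: "group_filtration G (\<lambda>i. H (2 * max 1 i))"
proof (unfold_locales)
  fix i j and a b
  assume "a \<in> H (2 * max 1 i)" "b \<in> H (2 * max 1 j)"
  then show "commutator G a b \<in> H (2 * max 1 (i + j))"
    by (rule commutator_H_le) (auto simp: max_def)
next
  fix i j :: nat assume "i \<le> j"
  then show "H (2 * max 1 j) \<subseteq> H (2 * max 1 i)"
    by (intro H_antimono) (auto simp: max_def)
qed (use H_closed in auto)

text \<open>
  In this filtration every element of \<open>H 1\<close> lies in the second term. The expansion of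
  \<open>step_product G x k\<close> requires weight 2 for the letter \<open>k\<close>, of which only \<open>k \<in> H 1\<close> is known.
\<close>

lemma half_filtration: "group_filtration G (\<lambda>i. H ((i + 1) div 2))"
proof (unfold_locales)
  fix i j and a b
  assume "a \<in> H ((i + 1) div 2)" "b \<in> H ((j + 1) div 2)"
  then show "commutator G a b \<in> H ((i + j + 1) div 2)"
    by (rule commutator_H_le) linarith
next
  fix i j :: nat assume "i \<le> j"
  then show "H ((j + 1) div 2) \<subseteq> H ((i + 1) div 2)"
    by (intro H_antimono div_le_mono) simp
qed (use H_closed in auto)

text \<open>
  The Hall-Petrescu formula in \<open>H 2\<close>, which has class at most 3: the Taylor expansion of the
  polynomial sequence \<open>(uv)^(-n) u^n v^n\<close> is \<open>c_2^(n choose 2) c_3^(n choose 3)\<close>. At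
  \<open>n = 3\<close> it expresses \<open>u^3 v^3\<close>; at \<open>n = 3^(e+1)\<close>, where all powers are trivial, it bounds the
  order of the same element \<open>c_3\<close>.
\<close>

lemma hall_petrescu_cubes:
  assumes H7: "H 7 = {\<one>}" and expo: "\<And>a. a \<in> H 2 \<Longrightarrow> a [^] (3 ^ Suc e :: nat) = \<one>"
    and uv: "u \<in> H 2" "v \<in> H 2"
  obtains c2 c3 where "c2 \<in> H 4" "c3 \<in> H 6" "c3 [^] (3 ^ e :: nat) = \<one>"
    "u [^] (3::nat) \<otimes> v [^] (3::nat) = (u \<otimes> v) [^] (3::nat) \<otimes> (c2 [^] (3::nat) \<otimes> c3)"
proof -
  interpret E: group_filtration G "\<lambda>i. H (2 * max 1 i)" by (rule even_filtration)
  define g where "g n = inv ((u \<otimes> v) [^] n) \<otimes> (u [^] n \<otimes> v [^] n)" for n :: nat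
  have g: "g \<in> E.Poly 0"
    unfolding g_def[abs_def] using uv
    by (intro E.Poly_mult E.Poly_inv E.Poly_pow) (auto simp: numeral_2_eq_2)
  define c where "c r = taylor_coeff G g r" for r
  have c: "c r \<in> H (2 * max 1 r)" for r
    unfolding c_def by (rule E.taylor_coeff_in_H[OF g])
  have cl [simp]: "u \<in> carrier G" "v \<in> carrier G" "c r \<in> carrier G" for r
    using uv c by blast+
  have g_cl [simp]: "g n \<in> carrier G" for n by (simp add: g_def)
  have c0: "c 0 = \<one>" by (simp add: c_def g_def)
  have c1: "c 1 = \<one>" using c0 by (simp add: c_def g_def)
  have c2: "c 2 \<in> H 4" and c3: "c 3 \<in> H 6"
    using c[of 2] c[of 3] by simp_all
  have rem: "taylor_rem G g (Suc r) n = inv (c r [^] (n choose r)) \<otimes> taylor_rem G g r n" for r n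
    by (simp add: c_def)
  have high: "taylor_rem G g (4 + r) n = taylor_rem G g 4 n" for r n
  proof (induction r)
    case (Suc r)
    have "c (4 + r) \<in> H 7"
      by (rule H_mono[OF c]) simp
    then have "c (4 + r) = \<one>" using H7 by simp
    moreover have "taylor_rem G g (4 + r) n \<in> carrier G"
      using E.taylor_rem_invariant[OF g, of "4 + r"] E.Poly_in_H by blast
    ultimately show ?case
      unfolding add_Suc_right rem using Suc.IH by simp
  qed simp
  have g_eq: "g n = c 2 [^] (n choose 2) \<otimes> c 3 [^] (n choose 3)" for n
  proof -
    have "taylor_rem G g 4 n = \<one>"
      using high[of "Suc n" n] E.taylor_rem_eq_one[OF g, of n "4 + Suc n"] by simp
    moreover have "taylor_rem G g 4 n = inv (c 3 [^] (n choose 3)) \<otimes> (inv (c 2 [^] (n choose 2)) \<otimes> g n)"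
      using c0 c1 by (simp add: eval_nat_numeral rem del: taylor_rem.simps(2))
    ultimately have eq: "inv (c 3 [^] (n choose 3)) \<otimes> (inv (c 2 [^] (n choose 2)) \<otimes> g n) = \<one>"
      by simp
    have "g n = c 2 [^] (n choose 2) \<otimes> (c 3 [^] (n choose 3) \<otimes>
        (inv (c 3 [^] (n choose 3)) \<otimes> (inv (c 2 [^] (n choose 2)) \<otimes> g n)))"
      by simp
    then show ?thesis unfolding eq by simp
  qed
  let ?N = "3 ^ Suc e :: nat"
  have "c 3 [^] (?N choose 3) = \<one>"
  proof -
    have "g ?N = \<one>"
      using uv by (simp add: g_def expo del: power_Suc)
    moreover have "c 2 [^] (?N choose 2) = \<one>"
    proof (rule pow_eq_one_dvd)
      show "c 2 [^] ?N = \<one>" by (rule expo) (use H_mono[OF c2, of 2] in simp)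
      show "?N dvd (?N choose 2)"
        using prime_power_dvd_binomial[of 3 2 0 2 "Suc e"] by simp
    qed simp
    ultimately show ?thesis using g_eq[of ?N] by simp
  qed
  moreover obtain t where t: "(?N choose 3) = 3 ^ e * t" "\<not> 3 dvd t"
    using binomial_3_power_3[of e] by blast
  moreover have "c 3 [^] ?N = \<one>"
    by (rule expo) (use H_mono[OF c3, of 2] in simp)
  moreover have "coprime 3 t"
    using t(2) by (intro prime_imp_coprime) auto
  ultimately have c3e: "c 3 [^] (3 ^ e :: nat) = \<one>"
    using pow_eq_one_coprime[of "c 3" "3 ^ e" 3 t] by (simp add: mult.commute)
  have "u [^] (3::nat) \<otimes> v [^] (3::nat) = (u \<otimes> v) [^] (3::nat) \<otimes> g 3"
    by (simp add: g_def)
  also have "g 3 = c 2 [^] (3::nat) \<otimes> c 3"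
    using g_eq[of 3] by (simp add: binomial_eq_0 choose_two)
  finally show thesis
    using that c2 c3 c3e by blast
qed

text \<open>
  A product of cubes need not be a cube, but \<open>hall_petrescu_cubes\<close> makes it one up to a factor in
  \<open>H 6\<close> killed by \<open>3^e\<close>. With these factors included the set is a subgroup, and it is still killed
  by \<open>3^e\<close> when \<open>3^(e+1)\<close> kills \<open>H 2\<close>.
\<close>

definition cubes_times_torsion :: "nat \<Rightarrow> 'a set" where
  "cubes_times_torsion e = {u [^] (3::nat) \<otimes> z | u z. u \<in> H 2 \<and> z \<in> H 6 \<and> z [^] (3 ^ e :: nat) = \<one>}"

lemma H6_central:
  assumes "H 7 = {\<one>}" "z \<in> H 6" "a \<in> H 1"
  shows "z \<otimes> a = a \<otimes> z"
  by (rule H_commute[OF assms]) simp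

lemma pow_mult_H6:
  assumes "H 7 = {\<one>}" "z \<in> H 6" "a \<in> H 1"
  shows "(a \<otimes> z) [^] (n::nat) = a [^] n \<otimes> z [^] n"
  using H6_central[OF assms] assms by (intro pow_mult_distrib) auto

lemma cubes_times_torsion_mult:
  assumes H7: "H 7 = {\<one>}" and expo: "\<And>a. a \<in> H 2 \<Longrightarrow> a [^] (3 ^ Suc e :: nat) = \<one>"
    and ab: "a \<in> cubes_times_torsion e" "b \<in> cubes_times_torsion e"
  shows "a \<otimes> b \<in> cubes_times_torsion e"
proof -
  obtain u z where a: "a = u [^] (3::nat) \<otimes> z" and u: "u \<in> H 2" and z: "z \<in> H 6" and ze: "z [^] (3 ^ e :: nat) = \<one>"
    using ab(1) by (auto simp: cubes_times_torsion_def)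
  obtain v y where b: "b = v [^] (3::nat) \<otimes> y" and v: "v \<in> H 2" and y: "y \<in> H 6" and ye: "y [^] (3 ^ e :: nat) = \<one>"
    using ab(2) by (auto simp: cubes_times_torsion_def)
  obtain c2 c3 where c2: "c2 \<in> H 4" and c3: "c3 \<in> H 6" "c3 [^] (3 ^ e :: nat) = \<one>"
    and uv: "u [^] (3::nat) \<otimes> v [^] (3::nat) = (u \<otimes> v) [^] (3::nat) \<otimes> (c2 [^] (3::nat) \<otimes> c3)"
    by (rule hall_petrescu_cubes[OF H7 expo u v])
  define w where "w = u \<otimes> v"
  have w: "w \<in> H 2" using u v by (simp add: w_def)
  obtain t where "t \<in> H (4 + 2)" and c2w: "c2 \<otimes> w = w \<otimes> (c2 \<otimes> t)"
    by (rule H_swap[OF c2 w])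
  then have t: "t \<in> H 6" by simp
  have cl [simp]: "u \<in> carrier G" "v \<in> carrier G" "w \<in> carrier G" "z \<in> carrier G" "y \<in> carrier G"
      "c2 \<in> carrier G" "c3 \<in> carrier G" "t \<in> carrier G"
    using u v w z y c2 c3 t by blast+
  have H61: "h \<in> H 1" if "h \<in> H i" "1 \<le> i" for h i using H_mono[OF that] .
  have central: "h \<otimes> k = k \<otimes> h" if "h \<in> H 6" "k \<in> H i" "1 \<le> i" for h k i
    by (rule H6_central[OF H7 that(1) H61[OF that(2,3)]])
  have tw: "t \<otimes> w = w \<otimes> t" and tc: "t \<otimes> c2 = c2 \<otimes> t"
    using central[OF t w] central[OF t c2] by simp_all
  have "(w \<otimes> c2) [^] (3::nat) = w [^] (3::nat) \<otimes> (c2 [^] (3::nat) \<otimes> t [^] (3::nat))"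
    by (simp add: pow_3 m_assoc c2w assoc_rule[OF c2w] tw assoc_rule[OF tw] tc assoc_rule[OF tc])
  then have wc: "w [^] (3::nat) \<otimes> c2 [^] (3::nat) = (w \<otimes> c2) [^] (3::nat) \<otimes> (inv t) [^] (3::nat)"
    by (simp add: m_assoc nat_pow_inv)
  have zv: "z \<otimes> v [^] (3::nat) = v [^] (3::nat) \<otimes> z"
    using central[OF z, of "v [^] (3::nat)" 2] v by simp
  have "a \<otimes> b = u [^] (3::nat) \<otimes> v [^] (3::nat) \<otimes> (z \<otimes> y)"
    unfolding a b by (simp add: m_assoc zv assoc_rule[OF zv])
  also have "\<dots> = (w [^] (3::nat) \<otimes> c2 [^] (3::nat)) \<otimes> (c3 \<otimes> (z \<otimes> y))"
    unfolding uv w_def[symmetric] by (simp add: m_assoc)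
  also have "\<dots> = (w \<otimes> c2) [^] (3::nat) \<otimes> ((inv t) [^] (3::nat) \<otimes> (c3 \<otimes> (z \<otimes> y)))"
    unfolding wc by (simp add: m_assoc)
  finally have ab_eq: "a \<otimes> b = \<dots>" .
  have "((inv t) [^] (3::nat) \<otimes> (c3 \<otimes> (z \<otimes> y))) [^] (3 ^ e :: nat) = \<one>"
  proof -
    have "(inv t) [^] (3 ^ Suc e :: nat) = \<one>"
      using expo H_mono[of "inv t" 6 2] t by simp
    then have "((inv t) [^] (3::nat)) [^] (3 ^ e :: nat) = \<one>"
      by (simp add: nat_pow_pow)
    moreover have "z \<otimes> y \<in> H 6" "c3 \<otimes> (z \<otimes> y) \<in> H 6" "(inv t) [^] (3::nat) \<in> H 6"
      using z y c3 t by simp_all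
    ultimately show ?thesis
      using ze ye c3(2) pow_mult_H6[OF H7] H61[of _ 6] z y c3(1) by simp
  qed
  moreover have "w \<otimes> c2 \<in> H 2" using w H_mono[OF c2, of 2] by simp
  moreover have "(inv t) [^] (3::nat) \<otimes> (c3 \<otimes> (z \<otimes> y)) \<in> H 6"
    using z y c3 t by simp
  ultimately show ?thesis
    unfolding cubes_times_torsion_def ab_eq by blast
qed

lemma cubes_times_torsion_pow:
  assumes H7: "H 7 = {\<one>}" and expo: "\<And>a. a \<in> H 2 \<Longrightarrow> a [^] (3 ^ Suc e :: nat) = \<one>"
    and a: "a \<in> cubes_times_torsion e"
  shows "a [^] (3 ^ e :: nat) = \<one>"
proof -
  obtain u z where az: "a = u [^] (3::nat) \<otimes> z" and u: "u \<in> H 2" and z: "z \<in> H 6" and ze: "z [^] (3 ^ e :: nat) = \<one>"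
    using a by (auto simp: cubes_times_torsion_def)
  have "u [^] (3::nat) \<in> H 1" using H_mono[OF u, of 1] by simp
  then show ?thesis
    unfolding az using pow_mult_H6[OF H7 z] ze expo[OF u] u H_closed[OF u]
    by (simp add: nat_pow_pow)
qed

lemma cubes_times_torsion_normal:
  assumes H7: "H 7 = {\<one>}" and expo: "\<And>a. a \<in> H 2 \<Longrightarrow> a [^] (3 ^ Suc e :: nat) = \<one>"
    and nrm: "H 2 \<lhd> G" "H 6 \<lhd> G"
  shows "cubes_times_torsion e \<lhd> G"
proof -
  have sub: "cubes_times_torsion e \<subseteq> carrier G"
    by (auto simp: cubes_times_torsion_def)
  show ?thesis
    unfolding normal_inv_iff
  proof (intro conjI ballI)
    show "subgroup (cubes_times_torsion e) G"
    proof
      show "cubes_times_torsion e \<subseteq> carrier G" by (rule sub)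
      show "a \<otimes> b \<in> cubes_times_torsion e" if "a \<in> cubes_times_torsion e" "b \<in> cubes_times_torsion e" for a b
        using H7 expo that by (rule cubes_times_torsion_mult)
      show "\<one> \<in> cubes_times_torsion e"
        unfolding cubes_times_torsion_def by (rule CollectI, intro exI[of _ \<one>]) simp
      show "inv a \<in> cubes_times_torsion e" if a: "a \<in> cubes_times_torsion e" for a
      proof -
        obtain u z where az: "a = u [^] (3::nat) \<otimes> z" and u: "u \<in> H 2" and z: "z \<in> H 6"
          and ze: "z [^] (3 ^ e :: nat) = \<one>"
          using a by (auto simp: cubes_times_torsion_def)
        have cl: "u \<in> carrier G" "z \<in> carrier G" using u z by auto
        have "inv z \<otimes> inv (u [^] (3::nat)) = inv (u [^] (3::nat)) \<otimes> inv z"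
          by (rule H_commute[OF H7, of _ 6 _ 2]) (use u z in auto)
        then have "inv a = (inv u) [^] (3::nat) \<otimes> inv z"
          using cl by (simp add: az inv_mult_group nat_pow_inv)
        moreover have "(inv z) [^] (3 ^ e :: nat) = \<one>"
          using cl ze by (simp add: nat_pow_inv)
        ultimately show ?thesis
          using u z unfolding cubes_times_torsion_def by blast
      qed
    qed
    fix g a assume g: "g \<in> carrier G" and "a \<in> cubes_times_torsion e"
    then obtain u z where az: "a = u [^] (3::nat) \<otimes> z" and u: "u \<in> H 2" and z: "z \<in> H 6"
          and ze: "z [^] (3 ^ e :: nat) = \<one>"
      by (auto simp: cubes_times_torsion_def)
    have cl: "u \<in> carrier G" "z \<in> carrier G" using u z by auto
    have "g \<otimes> a \<otimes> inv g = (g \<otimes> u \<otimes> inv g) [^] (3::nat) \<otimes> (g \<otimes> z \<otimes> inv g)"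
      unfolding conjugate_pow[OF g cl(1)] using cl g by (simp add: az m_assoc)
    moreover have "(g \<otimes> z \<otimes> inv g) [^] (3 ^ e :: nat) = \<one>"
      unfolding conjugate_pow[OF g cl(2)] using g ze by simp
    moreover have "g \<otimes> u \<otimes> inv g \<in> H 2" "g \<otimes> z \<otimes> inv g \<in> H 6"
      using nrm g u z by (simp_all add: normal_inv_iff)
    ultimately show "g \<otimes> a \<otimes> inv g \<in> cubes_times_torsion e"
      unfolding cubes_times_torsion_def by blast
  qed
qed


section \<open>The products along a filtration\<close>

lemma image_filtration:
  assumes "group_hom G G' h"
  shows "group_filtration G' (\<lambda>i. h ` H i)"
proof -
  interpret h: group_hom G G' h by fact
  show ?thesis
  proof (rule group_filtration.intro[OF h.H.is_group], rule group_filtration_axioms.intro)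
    fix i j a b
    assume "a \<in> h ` H i" "b \<in> h ` H j"
    then obtain a' b' where ab: "a = h a'" "b = h b'" "a' \<in> H i" "b' \<in> H j" by blast
    then have "commutator G' a b = h (commutator G a' b')"
      using H_closed[OF ab(3)] H_closed[OF ab(4)] by (simp add: commutator_def)
    then show "commutator G' a b \<in> h ` H (i + j)"
      using commutator_H[OF ab(3,4)] by blast
  next
    fix i j :: nat assume "i \<le> j"
    then show "h ` H j \<subseteq> h ` H i"
      by (intro image_mono H_antimono)
  qed (rule h.subgroup_img_is_subgroup[OF subgroup_H])
qed

lemma step_product_9_mod:
  assumes N: "N \<lhd> G" and H7: "H 7 = {\<one>}" and cube: "\<And>u. u \<in> H 2 \<Longrightarrow> u [^] (3::nat) \<in> N"
    and x: "x \<in> H 1" and k: "k \<in> H 1"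
  shows "inv (x [^] (9::nat) \<otimes> (inv x \<otimes> k \<otimes> x) [^] (36::nat)) \<otimes> step_product G x k 9 \<in> N"
proof -
  interpret N: normal N G by (rule N)
  let ?h = "\<lambda>a. N #> a"
  have hom: "group_hom G (G Mod N) ?h"
    by (intro group_hom.intro group_hom_axioms.intro N.r_coset_hom_Mod N.factorgroup_is_group is_group)
  interpret h: group_hom G "G Mod N" ?h by (rule hom)
  interpret Q: group_filtration "G Mod N" "\<lambda>i. ?h ` H i"
    by (rule image_filtration[OF hom])
  have cl: "x \<in> carrier G" "k \<in> carrier G" using x k by auto
  define q where "q = x [^] (9::nat) \<otimes> (inv x \<otimes> k \<otimes> x) [^] (36::nat)"
  have ker: "?h a = \<one>\<^bsub>G Mod N\<^esub> \<longleftrightarrow> a \<in> N" if "a \<in> carrier G" for a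
    using that N.subgroup_axioms coset_join1[of N a] coset_join2[of a N]
    by (auto simp: FactGroup_def N.subset)
  have Q7: "?h ` H 7 = {\<one>\<^bsub>G Mod N\<^esub>}"
    unfolding H7 image_insert image_empty h.hom_one by (rule refl)
  have cube_Q: "b [^]\<^bsub>G Mod N\<^esub> (3::nat) = \<one>\<^bsub>G Mod N\<^esub>" if b: "b \<in> ?h ` H 2" for b
  proof -
    obtain a where a: "a \<in> H 2" "b = ?h a" using b by (rule imageE)
    then have cl: "a \<in> carrier G" by auto
    have "?h a [^]\<^bsub>G Mod N\<^esub> (3::nat) = ?h (a [^] (3::nat))"
      by (rule h.hom_nat_pow[symmetric, OF cl])
    also have "\<dots> = \<one>\<^bsub>G Mod N\<^esub>"
      using cl by (intro iffD2[OF ker] cube a(1)) simp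
    finally show ?thesis unfolding a(2) .
  qed
  have "?h (step_product G x k 9) = step_product (G Mod N) (?h x) (?h k) 9"
    by (rule hom_step_product[OF hom cl])
  also have "\<dots> = ?h x [^]\<^bsub>G Mod N\<^esub> (9::nat) \<otimes>\<^bsub>G Mod N\<^esub>
      (inv\<^bsub>G Mod N\<^esub> (?h x) \<otimes>\<^bsub>G Mod N\<^esub> ?h k \<otimes>\<^bsub>G Mod N\<^esub> ?h x) [^]\<^bsub>G Mod N\<^esub> (36::nat)"
    by (rule Q.step_product_9[OF Q7 cube_Q imageI[OF x] imageI[OF k]])
  also have "\<dots> = ?h q"
    unfolding q_def using cl by (simp only: h.hom_nat_pow h.hom_mult h.hom_inv nat_pow_closed m_closed inv_closed)
  finally have eq: "?h (step_product G x k 9) = ?h q" .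
  have q: "q \<in> carrier G" using cl by (simp add: q_def)
  have "?h (inv q \<otimes> step_product G x k 9) = inv\<^bsub>G Mod N\<^esub> (?h q) \<otimes>\<^bsub>G Mod N\<^esub> ?h (step_product G x k 9)"
    using cl q by (simp only: h.hom_mult h.hom_inv step_product_closed inv_closed)
  also have "\<dots> = \<one>\<^bsub>G Mod N\<^esub>"
    unfolding eq by (rule h.H.l_inv[OF h.hom_closed[OF q]])
  finally show ?thesis
    using cl q unfolding q_def[symmetric] by (intro iffD1[OF ker]) simp_all
qed

text \<open>
  The difference of the sequence is \<open>x k^n\<close>, the product of a constant and a power sequence. A second
  difference turns \<open>k^n\<close> into the constant \<open>k\<close>, which is why \<open>k\<close> needs weight 2.
\<close>

lemma step_product_in_Poly:
  assumes x: "x \<in> H 1" and k: "k \<in> H 2"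
  shows "step_product G x k \<in> Poly 0"
proof (rule PolyI)
  have cl: "x \<in> carrier G" "k \<in> carrier G" using x k by auto
  have "step_product G x k n \<in> H 0" for n
    using H_mono[OF x, of 0] H_mono[OF k, of 0] by (induction n) auto
  then show "step_product G x k n \<in> H 0" for n .
  have "difference G (step_product G x k) = (\<lambda>n. x \<otimes> k [^] n)"
    using cl by (simp add: difference_def fun_eq_iff m_assoc)
  moreover have "(\<lambda>n. x \<otimes> k [^] n) \<in> Poly (Suc 0)"
    using x k by (intro Poly_mult Poly_const Poly_pow) (simp_all add: numeral_2_eq_2)
  ultimately show "difference G (step_product G x k) \<in> Poly (Suc 0)" by simp
qed

text \<open>
  The coefficients with index 0, 1, 2 are \<open>1\<close>, \<open>x\<close> and \<open>x^(-1) k x\<close>. Those with index 3 to 8 enter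
  the value at 9 as cubes of elements of \<open>H 2\<close>, since 3 divides \<open>9 choose r\<close>. So the
  ninth coefficient agrees modulo \<open>N\<close> with the remainder after three steps at 9, and
  \<open>step_product_9_mod\<close> puts this remainder into \<open>N\<close>.
\<close>

lemma ninth_coefficient:
  assumes N: "N \<lhd> G" and H7: "H 7 = {\<one>}" and cube: "\<And>u. u \<in> H 2 \<Longrightarrow> u [^] (3::nat) \<in> N"
    and x: "x \<in> H 1" and k: "k \<in> H 1"
  shows "taylor_coeff G (step_product G x k) 9 \<in> N"
proof -
  interpret N: normal N G by (rule N)
  interpret F: group_filtration G "\<lambda>i. H ((i + 1) div 2)" by (rule half_filtration)
  let ?g = "step_product G x k"
  have cl [simp]: "x \<in> carrier G" "k \<in> carrier G" using x k by auto
  have g: "?g \<in> F.Poly 0"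
    using x k by (intro F.step_product_in_Poly) simp_all
  have rem: "taylor_rem G ?g (Suc r) n = inv (taylor_coeff G ?g r [^] (n choose r)) \<otimes> taylor_rem G ?g r n" for r n
    by simp
  have c0: "taylor_coeff G ?g 0 = \<one>" by simp
  have c1: "taylor_coeff G ?g (Suc 0) = x" by simp
  have "taylor_rem G ?g (Suc (Suc 0)) 2 = inv (x [^] (2::nat)) \<otimes> (x \<otimes> (k \<otimes> x))"
    unfolding rem[of "Suc 0"] c1 by (simp add: numeral_2_eq_2)
  then have c2: "taylor_coeff G ?g (Suc (Suc 0)) = inv x \<otimes> k \<otimes> x"
    by (simp add: numeral_2_eq_2 m_assoc inv_mult_group del: taylor_rem.simps(2))
  have "taylor_rem G ?g (Suc (Suc (Suc 0))) 9 =
     inv ((inv x \<otimes> k \<otimes> x) [^] (9 choose 2)) \<otimes> (inv (x [^] (9::nat)) \<otimes> ?g 9)"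
    unfolding rem[of "Suc (Suc 0)"] c2
    unfolding rem[of "Suc 0"] c1
    unfolding rem[of 0] c0
    by (simp add: numeral_2_eq_2 del: step_product.simps)
  also have "\<dots> = inv (x [^] (9::nat) \<otimes> (inv x \<otimes> k \<otimes> x) [^] (36::nat)) \<otimes> ?g 9"
    by (simp add: choose_two inv_mult_group m_assoc del: step_product.simps)
  also have "\<dots> \<in> N"
    by (rule step_product_9_mod[OF N H7 cube x k])
  finally have start: "taylor_rem G ?g 3 9 \<in> N" by (simp only: numeral_3_eq_3)
  have "taylor_rem G ?g (3 + j) 9 \<in> N" if "j \<le> 6" for j
    using that
  proof (induction j)
    case 0
    then show ?case using start by simp
  next
    case (Suc j)
    let ?c = "taylor_coeff G ?g (3 + j)"
    have "?c \<in> H ((3 + j + 1) div 2)"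
      by (rule F.taylor_coeff_in_H[OF g])
    then have c: "?c \<in> H 2"
      by (rule H_mono) simp
    have "(3::nat) dvd 9 choose (3 + j)"
    proof -
      have "\<forall>i\<in>{3..8}. (3::nat) dvd (9 choose i)" by code_simp
      then show ?thesis using Suc.prems by simp
    qed
    then obtain q where q: "9 choose (3 + j) = 3 * q" by blast
    have "?c [^] (9 choose (3 + j)) = (?c [^] q) [^] (3::nat)"
      using H_closed[OF c] by (simp add: q nat_pow_pow mult.commute)
    also have "\<dots> \<in> N" using c by (intro cube H_pow)
    finally have "inv (?c [^] (9 choose (3 + j))) \<in> N" by (rule N.m_inv_closed)
    then show ?case
      unfolding add_Suc_right rem using Suc by (intro N.m_closed) simp_all
  qed
  from this[of 6] show ?thesis by simp
qed

text \<open>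
  The coefficient \<open>c_r\<close> lies in \<open>H\<close> of index \<open>r/2\<close> rounded up. The cases are: \<open>r = 1, 2\<close>, where the
  binomial coefficient has the full factor \<open>p^e\<close> as \<open>p\<close> is odd; \<open>3 \<le> r \<le> 12\<close>, where \<open>c_r\<close> is killed by
  \<open>p^(e-1)\<close> and \<open>p^2\<close> divides \<open>r\<close> only for \<open>p = 3\<close>, \<open>r = 9\<close>; and \<open>r \<ge> 13\<close>, where \<open>c_r = 1\<close>. In the
  exceptional case \<open>c_9\<close> has smaller order, by \<open>ninth_coefficient\<close>.
\<close>

theorem step_product_eq_one:
  fixes p e :: nat
  assumes p: "prime p" "p > 2" and H7: "H 7 = {\<one>}"
    and exp1: "\<And>a. a \<in> H 1 \<Longrightarrow> a [^] (p ^ e) = \<one>"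
    and exp2: "\<And>a. a \<in> H 2 \<Longrightarrow> a [^] (p ^ (e - 1)) = \<one>"
    and nrm: "H 2 \<lhd> G" "H 6 \<lhd> G"
    and x: "x \<in> H 1" and k: "k \<in> H 1"
  shows "step_product G x k (p ^ e) = \<one>"
proof -
  interpret F: group_filtration G "\<lambda>i. H ((i + 1) div 2)" by (rule half_filtration)
  let ?g = "step_product G x k"
  have g: "?g \<in> F.Poly 0"
    using x k by (intro F.step_product_in_Poly) simp_all
  show ?thesis
  proof (rule F.Poly_value_eq_one[OF g])
    fix r
    let ?c = "taylor_coeff G ?g r"
    have c: "?c \<in> H ((r + 1) div 2)"
      by (rule F.taylor_coeff_in_H[OF g])
    then have cl: "?c \<in> carrier G" by (rule H_closed)
    consider "r = 0" | "r = 1 \<or> r = 2" | "p = 3" "r = 9" | "3 \<le> r" "r \<le> 12" "\<not> (p = 3 \<and> r = 9)" | "13 \<le> r"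
      by linarith
    then show "?c [^] (p ^ e choose r) = \<one>"
    proof cases
      case 1
      then show ?thesis by simp
    next
      case 2
      then have "\<not> p dvd r" using p(2) by (auto dest: dvd_imp_le)
      then have "p ^ (e - 0) dvd (p ^ e choose r)"
        by (intro prime_power_dvd_binomial[OF p(1)]) simp_all
      moreover have "?c [^] (p ^ e) = \<one>"
        using c 2 by (intro exp1) auto
      ultimately show ?thesis using cl pow_eq_one_dvd by simp
    next
      case 3
      have c2: "?c \<in> H 2" using 3 by (intro H_mono[OF c]) simp
      show ?thesis
      proof (cases "e \<le> 1")
        case True
        then have "?c = \<one>" using exp2[OF c2] cl by simp
        then show ?thesis by simp
      next
        case False
        then obtain f where e: "e = Suc (Suc f)"
          by (metis One_nat_def Suc_le_mono bot_nat_0.extremum not0_implies_Suc)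
        have expo: "a [^] (3 ^ Suc f :: nat) = \<one>" if "a \<in> H 2" for a
          using exp2[OF that] 3 by (simp add: e)
        have "taylor_coeff G ?g 9 \<in> cubes_times_torsion f"
        proof (rule ninth_coefficient[OF _ H7 _ x k])
          show "cubes_times_torsion f \<lhd> G"
            using H7 expo nrm by (rule cubes_times_torsion_normal)
          show "u [^] (3::nat) \<in> cubes_times_torsion f" if "u \<in> H 2" for u
            unfolding cubes_times_torsion_def
            by (rule CollectI, rule exI[of _ u], rule exI[of _ \<one>]) (use that in simp)
        qed
        then have "?c \<in> cubes_times_torsion f" unfolding \<open>r = 9\<close> .
        with H7 expo have "?c [^] (3 ^ f :: nat) = \<one>"
          by (rule cubes_times_torsion_pow)
        moreover have "3 ^ f dvd (p ^ e choose r)"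
          using prime_power_dvd_binomial[of 3 9 2 1 e] unfolding e 3 by simp
        ultimately show ?thesis by (rule pow_eq_one_dvd[OF cl])
      qed
    next
      case 4
      have "?c [^] (p ^ (e - 1)) = \<one>"
        using 4 by (intro exp2 H_mono[OF c]) simp
      moreover have "p ^ (e - 1) dvd (p ^ e choose r)"
      proof (cases "p dvd r")
        case True
        then obtain j where j: "r = p * j" by blast
        have "\<not> p dvd j"
        proof
          assume "p dvd j"
          then obtain i where i: "j = p * i" by blast
          have "i \<noteq> 0"
          proof
            assume "i = 0"
            then show False using 4(1) j i by simp
          qed
          then have "p * p * 1 \<le> p * p * i" by (intro mult_le_mono) simp_all
          then have "p * p \<le> r" unfolding j i by (simp add: mult.assoc)
          moreover have "4 * 4 \<le> p * p" if "p \<noteq> 3"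
            using p(2) that by (intro mult_le_mono) linarith+
          ultimately have p3: "p = 3" using 4 by linarith
          then have "r = 9 * i" using i j by simp
          then have "i = 1" using 4 \<open>i \<noteq> 0\<close> by simp
          then show False using 4 p3 i j by simp
        qed
        then show ?thesis
          using prime_power_dvd_binomial[OF p(1), of r 1 j e] j by simp
      next
        case False
        then have "p ^ (e - 0) dvd (p ^ e choose r)"
          by (intro prime_power_dvd_binomial[OF p(1)]) simp_all
        moreover have "p ^ (e - 1) dvd p ^ e"
          by (rule le_imp_power_dvd) simp
        ultimately show ?thesis by (metis diff_zero dvd_trans)
      qed
      ultimately show ?thesis using cl pow_eq_one_dvd by blast
    next
      case 5
      have "?c \<in> H 7" by (rule H_mono[OF c]) (use 5 in simp)
      then show ?thesis using H7 by simp
    qed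
  qed
qed

end

context group begin

section \<open>The lower central series\<close>

lemma commutator_generate_right:
  assumes N: "N \<lhd> G" and a: "a \<in> carrier G" and B: "B \<subseteq> carrier G"
    and gens: "\<And>b. b \<in> B \<Longrightarrow> commutator G a b \<in> N"
    and b: "b \<in> generate G B"
  shows "commutator G a b \<in> N"
  using b
proof (induction b rule: generate.induct)
  interpret N: normal N G by (rule N)
  case one
  show ?case using a by (simp add: commutator_def)
next
  case (incl b)
  then show ?case by (rule gens)
next
  interpret N: normal N G by (rule N)
  case (inv b)
  then have b: "b \<in> carrier G" using B by blast
  have "inv b \<otimes> inv (commutator G a b) \<otimes> b \<in> N"
    using b inv gens by (intro N.inv_op_closed1) auto
  also have "inv b \<otimes> inv (commutator G a b) \<otimes> b = commutator G a (inv b)"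
    using a b by (simp add: commutator_def inv_mult_group m_assoc)
  finally show ?case .
next
  interpret N: normal N G by (rule N)
  case (eng b c)
  then have cl: "b \<in> carrier G" "c \<in> carrier G"
    using generate_in_carrier[OF B] by auto
  have "commutator G a b \<otimes> (b \<otimes> commutator G a c \<otimes> inv b) \<in> N"
    using cl eng by (intro N.m_closed N.inv_op_closed2)
  also have "commutator G a b \<otimes> (b \<otimes> commutator G a c \<otimes> inv b) = commutator G a (b \<otimes> c)"
    using a cl by (simp add: commutator_def inv_mult_group m_assoc)
  finally show ?case .
qed

lemma commutator_generate:
  assumes N: "N \<lhd> G" and AB: "A \<subseteq> carrier G" "B \<subseteq> carrier G"
    and gens: "\<And>a b. \<lbrakk>a \<in> A; b \<in> B\<rbrakk> \<Longrightarrow> commutator G a b \<in> N"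
    and ab: "a \<in> generate G A" "b \<in> generate G B"
  shows "commutator G a b \<in> N"
proof -
  interpret N: normal N G by (rule N)
  have b: "b \<in> carrier G" using generate_in_carrier AB(2) ab(2) by blast
  have a: "a \<in> carrier G" using generate_in_carrier AB(1) ab(1) by blast
  have "commutator G b a' \<in> N" if a': "a' \<in> A" for a'
  proof -
    have cl: "a' \<in> carrier G" using AB(1) a' by blast
    have "commutator G a' b \<in> N"
      by (rule commutator_generate_right[OF N cl AB(2) _ ab(2)]) (use gens a' in blast)
    then have "inv (commutator G a' b) \<in> N" by (rule N.m_inv_closed)
    then show ?thesis using cl b by (simp add: inv_commutator)
  qed
  then have "commutator G b a \<in> N"
    by (rule commutator_generate_right[OF N b AB(1) _ ab(1)])
  then have "inv (commutator G b a) \<in> N" by (rule N.m_inv_closed)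
  then show ?thesis using a b by (simp add: inv_commutator)
qed

lemma lower_central_1: "lower_central G (Suc 0) = carrier G"
  by (simp add: lower_central_def)

lemma lower_central_Suc:
  "1 \<le> i \<Longrightarrow> lower_central G (Suc i) =
     generate G {commutator G h k | h k. h \<in> lower_central G i \<and> k \<in> carrier G}"
proof -
  assume "1 \<le> i"
  then obtain j where "i = Suc j" using not0_implies_Suc by fastforce
  moreover have "(\<Union>h\<in>A. \<Union>k\<in>B. {h \<otimes> k \<otimes> inv h \<otimes> inv k}) = {commutator G h k | h k. h \<in> A \<and> k \<in> B}" for A B
    by (auto simp: commutator_def)
  ultimately show ?thesis
    by (simp add: lower_central_def commutator_subgroup_def)
qed

lemma conjugate_commutator:
  assumes "g \<in> carrier G" "a \<in> carrier G" "b \<in> carrier G"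
  shows "g \<otimes> commutator G a b \<otimes> inv g = commutator G (g \<otimes> a \<otimes> inv g) (g \<otimes> b \<otimes> inv g)"
  using assms by (simp add: commutator_def inv_mult_group m_assoc)

lemma lower_central_normal: "1 \<le> i \<Longrightarrow> lower_central G i \<lhd> G"
proof (induction i rule: nat_induct_at_least)
  case base
  then show ?case by (simp add: lower_central_1 normal_self)
next
  case (Suc i)
  interpret N: normal "lower_central G i" G by (rule Suc.IH)
  show ?case
    unfolding lower_central_Suc[OF Suc.hyps]
  proof (rule normal_generateI)
    show "{commutator G h k | h k. h \<in> lower_central G i \<and> k \<in> carrier G} \<subseteq> carrier G"
      by (auto simp: N.mem_carrier)
    fix c g assume "c \<in> {commutator G h k | h k. h \<in> lower_central G i \<and> k \<in> carrier G}" and g: "g \<in> carrier G"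
    then obtain h k where c: "c = commutator G h k" and hk: "h \<in> lower_central G i" "k \<in> carrier G" by blast
    have "g \<otimes> c \<otimes> inv g = commutator G (g \<otimes> h \<otimes> inv g) (g \<otimes> k \<otimes> inv g)"
      unfolding c by (rule conjugate_commutator[OF g N.mem_carrier[OF hk(1)] hk(2)])
    moreover have "g \<otimes> h \<otimes> inv g \<in> lower_central G i" "g \<otimes> k \<otimes> inv g \<in> carrier G"
      using g hk by (auto intro: N.inv_op_closed2)
    ultimately show "g \<otimes> c \<otimes> inv g \<in> {commutator G h k | h k. h \<in> lower_central G i \<and> k \<in> carrier G}"
      by blast
  qed
qed

lemma lower_central_subgroup: "1 \<le> i \<Longrightarrow> subgroup (lower_central G i) G"
  by (rule normal_imp_subgroup[OF lower_central_normal])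

lemma lower_central_closed: "\<lbrakk>a \<in> lower_central G i; 1 \<le> i\<rbrakk> \<Longrightarrow> a \<in> carrier G"
  using subgroup.mem_carrier[OF lower_central_subgroup] .

lemma commutator_lower_central_1:
  assumes "1 \<le> i" "a \<in> lower_central G i" "b \<in> carrier G"
  shows "commutator G a b \<in> lower_central G (Suc i)"
  unfolding lower_central_Suc[OF assms(1)] using assms(2,3) by (intro generate.incl) blast

lemma lower_central_antimono:
  assumes "1 \<le> i" "i \<le> j"
  shows "lower_central G j \<subseteq> lower_central G i"
  using assms(2)
proof (induction j rule: dec_induct)
  case (step j)
  have j: "1 \<le> j" using assms(1) step.hyps by simp
  interpret N: normal "lower_central G j" G by (rule lower_central_normal[OF j])
  have "lower_central G (Suc j) \<subseteq> lower_central G j"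
    unfolding lower_central_Suc[OF j]
  proof (rule generate_subgroup_incl[OF _ N.subgroup_axioms], clarify)
    fix h k assume hk: "h \<in> lower_central G j" "k \<in> carrier G"
    have cl: "h \<in> carrier G" using hk(1) by (rule N.mem_carrier)
    have "h \<otimes> (k \<otimes> inv h \<otimes> inv k) \<in> lower_central G j"
      using hk by (intro N.m_closed N.inv_op_closed2 N.m_inv_closed)
    then show "commutator G h k \<in> lower_central G j"
      using cl hk(2) by (simp add: commutator_def m_assoc)
  qed
  with step.IH show ?case by blast
qed simp

text \<open>
  Induction on \<open>j\<close>. It suffices to treat \<open>b = [h, k]\<close> with \<open>h\<close> in \<open>\<gamma>\<^sub>j\<close>. Conjugation by \<open>a\<close> multiplies
  \<open>h\<close> and \<open>k\<close> by \<open>\<alpha> = [a, h]\<close> in \<open>\<gamma>_(i+j)\<close> and \<open>\<beta> = [a, k]\<close> in \<open>\<gamma>_(i+1)\<close>, so \<open>commutator_mult_mult\<close> applies to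
  \<open>[a, [h, k]]\<close>. The terms with \<open>\<beta>\<close> are covered by the induction hypothesis for \<open>i+1\<close>.
\<close>

lemma commutator_lower_central:
  assumes "1 \<le> i" "1 \<le> j" "a \<in> lower_central G i" "b \<in> lower_central G j"
  shows "commutator G a b \<in> lower_central G (i + j)"
  using assms(2,1,3,4)
proof (induction j arbitrary: i a b rule: nat_induct_at_least)
  case base
  then show ?case
    using commutator_lower_central_1[of i a b] by (simp add: lower_central_1)
next
  case (Suc j)
  let ?N = "lower_central G (i + Suc j)"
  have N: "?N \<lhd> G" using Suc.prems by (intro lower_central_normal) simp
  interpret N: normal ?N G by (rule N)
  interpret Li: normal "lower_central G i" G by (rule lower_central_normal[OF Suc.prems(1)])
  interpret Lj: normal "lower_central G j" G by (rule lower_central_normal[OF Suc.hyps])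
  have a: "a \<in> carrier G" using Suc.prems(2) by (rule Li.mem_carrier)
  show ?case
  proof (rule commutator_generate_right[OF N a _ _ Suc.prems(3)[unfolded lower_central_Suc[OF Suc.hyps]]])
    show "{commutator G h k | h k. h \<in> lower_central G j \<and> k \<in> carrier G} \<subseteq> carrier G"
      by (auto simp: Lj.mem_carrier)
    fix c assume "c \<in> {commutator G h k | h k. h \<in> lower_central G j \<and> k \<in> carrier G}"
    then obtain h k where c: "c = commutator G h k" and h: "h \<in> lower_central G j" and k: "k \<in> carrier G"
      by blast
    have h': "h \<in> carrier G" using h by (rule Lj.mem_carrier)
    define \<alpha> \<beta> where "\<alpha> = commutator G a h" and "\<beta> = commutator G a k"
    have \<alpha>: "\<alpha> \<in> lower_central G (i + j)"
      unfolding \<alpha>_def using Suc.prems h by (intro Suc.IH)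
    have \<beta>: "\<beta> \<in> lower_central G (Suc i)"
      unfolding \<beta>_def using Suc.prems k by (intro commutator_lower_central_1)
    have cl: "\<alpha> \<in> carrier G" "\<beta> \<in> carrier G" "c \<in> carrier G"
      using a h' k by (simp_all add: \<alpha>_def \<beta>_def c)
    have "commutator G \<beta> h \<in> lower_central G (Suc i + j)"
      using \<beta> h by (intro Suc.IH) simp_all
    then have "inv (commutator G \<beta> h) \<in> ?N"
      by (intro N.m_inv_closed) simp
    then have "commutator G h \<beta> \<in> ?N"
      using cl h' by (simp add: inv_commutator)
    then have 1: "\<alpha> \<otimes> commutator G h \<beta> \<otimes> inv \<alpha> \<in> ?N"
      using cl by (intro N.inv_op_closed2)
    have \<alpha>N: "commutator G \<alpha> g \<in> ?N" if "g \<in> carrier G" for g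
      using commutator_lower_central_1[OF _ \<alpha> that] Suc.prems by simp
    have "c \<in> lower_central G (Suc j)"
      unfolding c using Suc.hyps h k by (rule commutator_lower_central_1)
    then have "c \<in> lower_central G j"
      using lower_central_antimono[of j "Suc j"] Suc.hyps by auto
    then have "commutator G \<beta> c \<in> lower_central G (Suc i + j)"
      using \<beta> by (intro Suc.IH) simp_all
    then have \<beta>c: "commutator G \<beta> c \<in> ?N" by simp
    have "\<alpha> \<otimes> commutator G \<beta> c \<otimes> inv \<alpha> \<otimes> commutator G \<alpha> c \<in> ?N"
      using cl by (intro N.m_closed N.inv_op_closed2 \<alpha>N \<beta>c)
    also have "\<alpha> \<otimes> commutator G \<beta> c \<otimes> inv \<alpha> \<otimes> commutator G \<alpha> c = commutator G (\<alpha> \<otimes> \<beta>) c"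
      using cl by (simp add: commutator_def inv_mult_group m_assoc)
    finally have 2: "commutator G (\<alpha> \<otimes> \<beta>) c \<in> ?N" .
    have 3: "c \<otimes> commutator G \<alpha> (\<beta> \<otimes> k) \<otimes> inv c \<in> ?N"
      using cl k by (intro N.inv_op_closed2 \<alpha>N) auto
    have ah: "a \<otimes> h \<otimes> inv a = \<alpha> \<otimes> h" and ak: "a \<otimes> k \<otimes> inv a = \<beta> \<otimes> k"
      using a h' k by (simp_all add: \<alpha>_def \<beta>_def conjugate_eq_commutator)
    have "commutator G a c = (a \<otimes> c \<otimes> inv a) \<otimes> inv c"
      by (simp add: commutator_def)
    also have "\<dots> = commutator G (\<alpha> \<otimes> h) (\<beta> \<otimes> k) \<otimes> inv (commutator G h k)"
      unfolding c conjugate_commutator[OF a h' k] ah ak ..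
    also have "\<dots> = (\<alpha> \<otimes> commutator G h \<beta> \<otimes> inv \<alpha>) \<otimes>
        (commutator G (\<alpha> \<otimes> \<beta>) c \<otimes> (c \<otimes> commutator G \<alpha> (\<beta> \<otimes> k) \<otimes> inv c))"
      unfolding c by (rule commutator_mult_mult[OF cl(1,2) h' k])
    also have "\<dots> \<in> ?N" by (intro N.m_closed 1 2 3)
    finally show "commutator G a c \<in> ?N" .
  qed
qed

text \<open>
  The lower central series of \<open>G\<close> itself would not do: \<open>[G, G]\<close> is not contained in \<open>\<gamma>_(d+1)\<close> in general. The
  subgroup generated by \<open>x\<close> and \<open>\<gamma>\<^sub>d\<close> contains both letters of the product, and its commutators do
  lie there, as any two of these generators commute modulo \<open>\<gamma>_(d+1)\<close>.
\<close>

definition central_filtration :: "'a \<Rightarrow> nat \<Rightarrow> nat \<Rightarrow> 'a set" where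
  "central_filtration x d i =
     (if i \<le> 1 then generate G (insert x (lower_central G d)) else lower_central G (d + i - 1))"

lemma central_filtration:
  assumes x: "x \<in> carrier G" and d: "1 \<le> d"
  shows "group_filtration G (central_filtration x d)"
proof -
  let ?L = "central_filtration x d"
  let ?A = "insert x (lower_central G d)"
  have A: "?A \<subseteq> carrier G"
    using x lower_central_closed[OF _ d] by auto
  have closed: "a \<in> carrier G" if "a \<in> ?L i" for a i
    using that generate_in_carrier[OF A] lower_central_closed d
    by (auto simp: central_filtration_def split: if_splits)
  have low: "?L i \<subseteq> lower_central G (d + i - 1)" if "2 \<le> i" for i
    using that by (simp add: central_filtration_def)
  have top: "commutator G a b \<in> lower_central G (Suc d)" if "a \<in> generate G ?A" "b \<in> generate G ?A" for a b
  proof (rule commutator_generate[OF lower_central_normal A A _ that])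
    interpret N: normal "lower_central G (Suc d)" G by (rule lower_central_normal) simp
    fix a b assume ab: "a \<in> ?A" "b \<in> ?A"
    have "commutator G x x = \<one>" using x by (simp add: commutator_def m_assoc)
    moreover have "commutator G h k \<in> lower_central G (Suc d)" if "h \<in> lower_central G d" "k \<in> carrier G" for h k
      using that by (intro commutator_lower_central_1 d)
    moreover have "commutator G k h \<in> lower_central G (Suc d)" if "h \<in> lower_central G d" "k \<in> carrier G" for h k
      using that N.m_inv_closed[OF commutator_lower_central_1[OF d that]] lower_central_closed[OF that(1) d]
      by (simp add: inv_commutator)
    ultimately show "commutator G a b \<in> lower_central G (Suc d)"
      using ab A x by auto
  qed simp
  show ?thesis
  proof (rule group_filtration.intro[OF is_group], rule group_filtration_axioms.intro)
    show "subgroup (?L i) G" for i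
      using d generate_is_subgroup[OF A] lower_central_subgroup[of "d + i - 1"]
      by (simp add: central_filtration_def)
  next
    fix i j :: nat assume ij: "i \<le> j"
    show "?L j \<subseteq> ?L i"
    proof (cases "j \<le> 1")
      case True
      then show ?thesis using ij by (simp add: central_filtration_def)
    next
      case j: False
      show ?thesis
      proof (cases "i \<le> 1")
        case True
        have "lower_central G (d + j - 1) \<subseteq> lower_central G d"
          using j d by (intro lower_central_antimono) auto
        then show ?thesis
          using True j by (auto simp: central_filtration_def intro: generate.incl)
      next
        case False
        then show ?thesis
          using ij j d lower_central_antimono[of "d + i - 1" "d + j - 1"]
          by (simp add: central_filtration_def)
      qed
    qed
  next
    fix a b i j assume a: "a \<in> ?L i" and b: "b \<in> ?L j"
    have cl: "a \<in> carrier G" "b \<in> carrier G" using a b closed by auto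
    have mono: "c \<in> ?L l" if c: "c \<in> lower_central G r" and dl: "d + l - 1 \<le> r" and dr: "d + 1 \<le> r" for c l r
    proof -
      have "c \<in> lower_central G (d + l - 1)" if "2 \<le> l"
        by (rule subsetD[OF lower_central_antimono c]) (use that dl d in auto)
      moreover have "c \<in> lower_central G d"
        by (rule subsetD[OF lower_central_antimono c]) (use dr d in auto)
      ultimately show ?thesis
        by (auto simp: central_filtration_def intro: generate.incl)
    qed
    consider "i \<le> 1" "j \<le> 1" | "i \<le> 1" "2 \<le> j" | "2 \<le> i" "j \<le> 1" | "2 \<le> i" "2 \<le> j" by linarith
    then show "commutator G a b \<in> ?L (i + j)"
    proof cases
      case 1
      then have "commutator G a b \<in> lower_central G (Suc d)"
        using a b by (intro top) (simp_all add: central_filtration_def)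
      then show ?thesis by (rule mono) (use 1 d in auto)
    next
      case 2
      have "commutator G b a \<in> lower_central G (Suc (d + j - 1))"
        using low[OF 2(2)] b cl d 2 by (intro commutator_lower_central_1) auto
      then have "inv (commutator G b a) \<in> lower_central G (Suc (d + j - 1))"
        by (rule subgroup.m_inv_closed[OF lower_central_subgroup, rotated]) simp
      then show ?thesis
        unfolding inv_commutator[OF cl(2,1)] by (rule mono) (use 2 d in auto)
    next
      case 3
      have "commutator G a b \<in> lower_central G (Suc (d + i - 1))"
        using low[OF 3(1)] a cl d 3 by (intro commutator_lower_central_1) auto
      then show ?thesis by (rule mono) (use 3 d in auto)
    next
      case 4
      have "commutator G a b \<in> lower_central G ((d + i - 1) + (d + j - 1))"
        using low[OF 4(1)] low[OF 4(2)] a b d 4 by (intro commutator_lower_central) auto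
      then show ?thesis by (rule mono) (use 4 d in auto)
    qed
  qed
qed

end

context group begin

section \<open>From trivial products to J-groups and witnesses\<close>

lemma foldr_eq_step_product:
  assumes "x \<in> carrier G" "k \<in> carrier G"
  shows "foldr (\<otimes>) (map (\<lambda>i. x \<otimes> k [^] (n - i)) [1..<Suc n]) \<one> = step_product G x k n"
proof (induction n)
  case (Suc n)
  have "[1..<Suc (Suc n)] = 1 # map Suc [1..<Suc n]"
    by (simp add: upt_conv_Cons map_Suc_upt del: upt_Suc)
  then show ?case
    using Suc.IH assms by (simp add: comp_def m_assoc del: upt_Suc)
qed simp

lemma step_product_periodic:
  assumes cl: "x \<in> carrier G" "k \<in> carrier G" and n: "k [^] n = \<one>" "step_product G x k n = \<one>"
  shows "step_product G x k (i + n * q) = step_product G x k i"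
proof (induction q)
  case (Suc q)
  have "step_product G x k (j + n) = step_product G x k j" for j
  proof (induction j)
    case (Suc j)
    have "k [^] (j + n) = k [^] j" using cl n(1) by (simp flip: nat_pow_mult)
    then show ?case using Suc.IH by simp
  qed (simp add: n)
  from this[of "i + n * q"] Suc.IH show ?case by (simp add: add_ac)
qed simp

text \<open>
  Choose a representative \<open>r\<close> in each coset of \<open>\<langle>k\<rangle>\<close> and put \<open>f(r k^i) = step_product G r k i\<close>. The
  recursion of \<open>step_product\<close> is the functional equation of \<open>f\<close>, and periodicity makes \<open>f\<close>
  independent of the choice of \<open>i\<close>.
\<close>

lemma J_group_if_step_product_eq_one:
  assumes k: "k \<in> carrier G" and n: "n > 0" "k [^] n = \<one>" "\<And>i. k [^] i = \<one> \<Longrightarrow> n dvd i"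
    and one: "\<And>x. x \<in> carrier G \<Longrightarrow> step_product G x k n = \<one>"
  shows "J_group G"
proof -
  define P where "P y r \<longleftrightarrow> r \<in> carrier G \<and> (\<exists>i::nat. y = r \<otimes> k [^] i)" for y r
  define rep where "rep y = (SOME r. P y r)" for y
  define ind where "ind y = (SOME i::nat. y = rep y \<otimes> k [^] i)" for y
  have "P y (rep y)" if "y \<in> carrier G" for y
    unfolding rep_def by (rule someI[of _ y]) (auto simp: P_def that intro: exI[of _ 0])
  then have rep: "rep y \<in> carrier G" and ex: "\<exists>i::nat. y = rep y \<otimes> k [^] i" if "y \<in> carrier G" for y
    using that by (simp_all add: P_def)
  have ind: "rep y \<otimes> k [^] ind y = y" if "y \<in> carrier G" for y
    using someI_ex[OF ex[OF that]] by (simp add: ind_def)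
  have rep_k: "rep (y \<otimes> k) = rep y" if y: "y \<in> carrier G" for y
  proof -
    have "P (y \<otimes> k) r \<longleftrightarrow> P y r" for r
    proof
      assume "P y r"
      then obtain i :: nat where "r \<in> carrier G" "y = r \<otimes> k [^] i" by (auto simp: P_def)
      then have "r \<in> carrier G" "y \<otimes> k = r \<otimes> k [^] Suc i" using k by (simp_all add: m_assoc)
      then show "P (y \<otimes> k) r" unfolding P_def by blast
    next
      assume "P (y \<otimes> k) r"
      then obtain i :: nat where r: "r \<in> carrier G" and i: "y \<otimes> k = r \<otimes> k [^] i" by (auto simp: P_def)
      have "k \<otimes> k [^] (n - 1) = k [^] n" using k n(1) by (simp flip: nat_pow_Suc2)
      then have "y = (y \<otimes> k) \<otimes> k [^] (n - 1)" using k y n by (simp add: m_assoc)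
      also have "\<dots> = r \<otimes> k [^] (i + (n - 1))"
        unfolding i using r k by (simp add: m_assoc nat_pow_mult)
      finally show "P y r" unfolding P_def using r by blast
    qed
    then show ?thesis by (simp add: rep_def)
  qed
  have well_defined: "step_product G r k i = step_product G r k j"
    if r: "r \<in> carrier G" and eq: "k [^] i = k [^] j" for r and i j :: nat
  proof -
    have *: "step_product G r k i = step_product G r k j" if "i \<le> j" "k [^] i = k [^] j" for i j :: nat
    proof -
      have "k [^] i \<otimes> k [^] (j - i) = k [^] j"
        using that(1) k by (simp add: nat_pow_mult)
      also have "\<dots> = k [^] i \<otimes> \<one>"
        using that(2) k by simp
      finally have "k [^] (j - i) = \<one>"
        using k by (subst (asm) Units_l_cancel) (simp_all add: Units_eq)
      then obtain q where "j - i = n * q" using n(3) by blast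
      then have "j = i + n * q" using that by simp
      then show ?thesis
        using step_product_periodic[OF r k n(2) one[OF r]] by simp
    qed
    show ?thesis
    proof (cases "i \<le> j")
      case True
      then show ?thesis using eq by (rule *)
    next
      case False
      then have "j \<le> i" by simp
      then show ?thesis using eq[symmetric] by (rule *[symmetric])
    qed
  qed
  define f where "f y = step_product G (rep y) k (ind y)" for y
  have "f (y \<otimes> k) = y \<otimes> f y" if y: "y \<in> carrier G" for y
  proof -
    have "rep y \<otimes> k [^] ind (y \<otimes> k) = (rep y \<otimes> k [^] ind y) \<otimes> k"
      using ind[of "y \<otimes> k"] ind[OF y] y k by (simp add: rep_k)
    then have "rep y \<otimes> k [^] ind (y \<otimes> k) = rep y \<otimes> k [^] Suc (ind y)"
      using rep[OF y] k by (simp add: m_assoc)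
    then have "k [^] ind (y \<otimes> k) = k [^] Suc (ind y)"
      using rep[OF y] k by (subst (asm) Units_l_cancel) (simp_all add: Units_eq)
    then have "f (y \<otimes> k) = step_product G (rep y) k (Suc (ind y))"
      unfolding f_def rep_k[OF y] by (intro well_defined rep y)
    also have "\<dots> = (rep y \<otimes> k [^] ind y) \<otimes> f y"
      using rep[OF y] k by (simp add: f_def m_assoc)
    finally show ?thesis using ind[OF y] by simp
  qed
  moreover have "f \<in> carrier G \<rightarrow> carrier G"
  proof
    fix y assume "y \<in> carrier G"
    then show "f y \<in> carrier G" using rep k by (simp add: f_def)
  qed
  ultimately show ?thesis
    using is_group k by (auto simp: J_group_def)
qed

lemma ord_subgroup:
  assumes "subgroup N G"
  shows "group.ord (G\<lparr>carrier := N\<rparr>) x = ord x"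
  using group.ord_def[OF subgroup.subgroup_is_group[OF assms is_group]]
  by (simp add: ord_def flip: nat_pow_consistent)

text \<open>
  In a \<open>p\<close>-group the orders form a chain under divisibility, so the exponent is the largest order and is
  attained.
\<close>

lemma p_group_exponent:
  assumes p: "prime p" and fin: "finite (carrier G)" and card: "order G = p ^ m" and N: "subgroup N G"
  obtains f k where "group_exponent (G\<lparr>carrier := N\<rparr>) = p ^ f" "k \<in> N" "ord k = p ^ f"
    "\<And>a. a \<in> N \<Longrightarrow> ord a dvd p ^ f"
proof -
  have sub: "N \<subseteq> carrier G" using N by (rule subgroup.subset)
  have pw: "\<exists>i. ord a = p ^ i" if "a \<in> N" for a
  proof -
    have "ord a dvd p ^ m"
      using ord_dvd_group_order[of a] sub that card by auto
    then show ?thesis using p by (auto simp: divides_primepow_nat)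
  qed
  have finN: "finite (ord ` N)" using fin sub finite_subset by blast
  have "N \<noteq> {}" using subgroup.one_closed[OF N] by blast
  then have "Max (ord ` N) \<in> ord ` N" using finN by (intro Max_in) auto
  then obtain k where k: "k \<in> N" "ord k = Max (ord ` N)" by auto
  obtain f where f: "ord k = p ^ f" using pw[OF k(1)] by blast
  have dvd: "ord a dvd p ^ f" if a: "a \<in> N" for a
  proof -
    obtain i where i: "ord a = p ^ i" using pw[OF a] by blast
    have "p ^ i \<le> p ^ f"
      using Max_ge[OF finN imageI[OF a]] k(2) f i by simp
    then have "i \<le> f" using prime_gt_1_nat[OF p] by simp
    then show ?thesis unfolding i by (rule le_imp_power_dvd)
  qed
  have "group_exponent (G\<lparr>carrier := N\<rparr>) = Lcm (ord ` N)"
    by (simp add: group_exponent_def ord_subgroup[OF N])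
  also have "\<dots> = p ^ f"
  proof (rule dvd_antisym)
    show "Lcm (ord ` N) dvd p ^ f" using dvd by (intro Lcm_least) auto
    show "p ^ f dvd Lcm (ord ` N)" using k(1) f by (intro dvd_Lcm) (metis imageI)
  qed
  finally show thesis using that k(1) f dvd by blast
qed

lemma nilpotency_class_leD:
  assumes "nilpotency_class G \<le> enat c"
  shows "lower_central G (Suc c) = {\<one>}"
proof -
  let ?C = "{c. lower_central G (Suc c) = {\<one>}}"
  have "?C \<noteq> {}"
  proof
    assume "?C = {}"
    then show False using assms by (simp add: nilpotency_class_def top_enat_def)
  qed
  then obtain c' where "c' \<in> ?C" by blast
  then have "(INF c\<in>?C. enat c) \<in> enat ` ?C"
    by (intro wellorder_InfI[of "enat c'"] imageI)
  then obtain b where b: "b \<in> ?C" "nilpotency_class G = enat b"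
    unfolding nilpotency_class_def by auto
  then have "lower_central G (Suc c) \<subseteq> {\<one>}"
    using lower_central_antimono[of "Suc b" "Suc c"] assms by auto
  moreover have "\<one> \<in> lower_central G (Suc c)"
    by (rule subgroup.one_closed[OF lower_central_subgroup]) simp
  ultimately show ?thesis by blast
qed

text \<open>
  The exponent of \<open>\<gamma>_(d+1)\<close> divides \<open>p^e\<close> and differs from it by maximality of \<open>d\<close>, so it divides
  \<open>p^(e-1)\<close>. In the trivial group \<open>e = 0\<close>, the truncated \<open>p^(e-1)\<close> is 1, and the claims
  hold for \<open>d = 1\<close>.
\<close>

lemma last_full_exponent_index:
  assumes p: "prime p" and fin: "finite (carrier G)" and card: "order G = p ^ m"
    and triv: "lower_central G (Suc c) = {\<one>}"
  obtains e k where "1 \<le> last_full_exponent_index G"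
    "\<And>a. a \<in> carrier G \<Longrightarrow> a [^] (p ^ e) = \<one>"
    "group_exponent (G\<lparr>carrier := lower_central G (last_full_exponent_index G)\<rparr>) = p ^ e"
    "k \<in> lower_central G (last_full_exponent_index G)" "ord k = p ^ e"
    "\<And>a. a \<in> lower_central G (Suc (last_full_exponent_index G)) \<Longrightarrow> a [^] (p ^ (e - 1)) = \<one>"
proof -
  note thesis = that
  note exponent = p_group_exponent[OF p fin card]
  obtain e k' where e: "group_exponent (G\<lparr>carrier := carrier G\<rparr>) = p ^ e"
      and "k' \<in> carrier G" "ord k' = p ^ e"
      and ord_dvd: "\<And>a. a \<in> carrier G \<Longrightarrow> ord a dvd p ^ e"
    by (rule exponent[OF subgroup_self]) (rule that)
  then have eG: "group_exponent G = p ^ e" by simp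
  define d where "d = last_full_exponent_index G"
  have tail: "lower_central G i = {\<one>}" if "Suc c \<le> i" for i
    using lower_central_antimono[OF _ that] triv that
      subgroup.one_closed[OF lower_central_subgroup[of i]] by auto
  have d: "1 \<le> d \<and> group_exponent (G\<lparr>carrier := lower_central G d\<rparr>) = p ^ e \<and>
     (\<forall>a\<in>lower_central G (Suc d). a [^] (p ^ (e - 1)) = \<one>)"
  proof (cases "carrier G = {\<one>}")
    case True
    then have "d = 1" by (simp add: d_def last_full_exponent_index_def)
    moreover have "lower_central G 2 \<subseteq> {\<one>}"
      using lower_central_antimono[of 1 2] True by (simp add: lower_central_1)
    ultimately show ?thesis
      using e by (auto simp: lower_central_1 numeral_2_eq_2)
  next
    case False
    let ?P = "\<lambda>d. 1 \<le> d \<and> group_exponent (G\<lparr>carrier := lower_central G d\<rparr>) = group_exponent G"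
    have d_eq: "d = (GREATEST d. ?P d)"
      using False by (simp add: d_def last_full_exponent_index_def)
    have P1: "?P 1" by (simp add: lower_central_1)
    have bound: "i \<le> c" if "?P i" for i
    proof (rule ccontr)
      assume "\<not> i \<le> c"
      then have 1: "lower_central G i = {\<one>}" by (intro tail) simp
      then have "subgroup {\<one>} G" using triv_subgroup by simp
      then have "group_exponent G = 1"
        using \<open>?P i\<close> 1 by (simp add: group_exponent_def ord_subgroup)
      then have "ord a = 1" if "a \<in> carrier G" for a
        using ord_dvd[OF that] unfolding eG[symmetric] by simp
      then have "carrier G \<subseteq> {\<one>}" using ord_eq_1 by blast
      then show False using False by auto
    qed
    have Pd: "?P d" unfolding d_eq by (rule GreatestI_nat[of ?P, OF P1 bound])
    have notP: "\<not> ?P (Suc d)"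
    proof
      assume "?P (Suc d)"
      then have "Suc d \<le> d" using Greatest_le_nat[of ?P "Suc d" c] bound d_eq by auto
      then show False by simp
    qed
    have "1 \<le> Suc d" by simp
    then obtain f k where f: "group_exponent (G\<lparr>carrier := lower_central G (Suc d)\<rparr>) = p ^ f"
      and k: "k \<in> lower_central G (Suc d)" "ord k = p ^ f"
      and f_dvd: "\<And>a. a \<in> lower_central G (Suc d) \<Longrightarrow> ord a dvd p ^ f"
      by (rule exponent[OF lower_central_subgroup]) (rule that)
    have "p ^ f dvd p ^ e"
      using ord_dvd[of k] k lower_central_closed[OF k(1)] by simp
    then have "f \<le> e" by (rule power_dvd_imp_le[OF _ prime_gt_1_nat[OF p]])
    moreover have "f \<noteq> e" using notP f eG by auto
    ultimately have "p ^ f dvd p ^ (e - 1)" by (intro le_imp_power_dvd) simp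
    then have "a [^] (p ^ (e - 1)) = \<one>" if "a \<in> lower_central G (Suc d)" for a
      using f_dvd[OF that] lower_central_closed[OF that] by (simp add: pow_eq_id) (metis dvd_trans)
    then show ?thesis using Pd eG by simp
  qed
  obtain f k where "group_exponent (G\<lparr>carrier := lower_central G d\<rparr>) = p ^ f"
      and k: "k \<in> lower_central G d" "ord k = p ^ f"
      and "\<And>a. a \<in> lower_central G d \<Longrightarrow> ord a dvd p ^ f"
    using exponent[OF lower_central_subgroup[of d]] d by blast
  with d have "ord k = p ^ e" by simp
  moreover have "a [^] (p ^ e) = \<one>" if "a \<in> carrier G" for a
    using ord_dvd[OF that] that by (simp add: pow_eq_id)
  ultimately show thesis
    using thesis d k(1) unfolding d_def by blast
qed

lemma step_product_lower_central:
  fixes p e d :: nat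
  assumes p: "prime p" "p > 2" and triv: "lower_central G 7 = {\<one>}" and d: "1 \<le> d"
    and exp1: "\<And>a. a \<in> carrier G \<Longrightarrow> a [^] (p ^ e) = \<one>"
    and exp2: "\<And>a. a \<in> lower_central G (Suc d) \<Longrightarrow> a [^] (p ^ (e - 1)) = \<one>"
    and x: "x \<in> carrier G" and k: "k \<in> lower_central G d"
  shows "step_product G x k (p ^ e) = \<one>"
proof -
  interpret L: group_filtration G "central_filtration x d"
    by (rule central_filtration[OF x d])
  have L: "central_filtration x d i = lower_central G (d + i - 1)" if "2 \<le> i" for i
    using that by (simp add: central_filtration_def)
  have L1: "central_filtration x d 1 = generate G (insert x (lower_central G d))"
    by (simp add: central_filtration_def)
  show ?thesis
  proof (rule L.step_product_eq_one[OF p])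
    have "central_filtration x d 7 \<subseteq> {\<one>}"
      using lower_central_antimono[of 7 "d + 7 - 1"] triv d by (simp add: L)
    then show "central_filtration x d 7 = {\<one>}"
      using L.H_one[of 7] by blast
    show "a [^] (p ^ e) = \<one>" if "a \<in> central_filtration x d 1" for a
      by (rule exp1[OF L.H_closed[OF that]])
    show "a [^] (p ^ (e - 1)) = \<one>" if "a \<in> central_filtration x d 2" for a
      using that L[of 2] by (intro exp2) simp
    show "central_filtration x d 2 \<lhd> G" "central_filtration x d 6 \<lhd> G"
      using d by (simp_all add: L lower_central_normal)
    show "x \<in> central_filtration x d 1" "k \<in> central_filtration x d 1"
      using k unfolding L1 by (auto intro: generate.incl)
  qed
qed

end

theorem corollary4p11:
  fixes G :: "('a, 'b) monoid_scheme" and p m d :: nat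
  assumes "prime p" and "p > 2"
    and "group G" and "finite (carrier G)" and "order G = p ^ m"
    and "nilpotency_class G \<le> 6"
    and "d = last_full_exponent_index G"
  shows "J_group G \<and>
    full_order_elements (G\<lparr>carrier := lower_central G d\<rparr>) \<subseteq> witnesses G"
proof -
  interpret group G by fact
  have triv: "lower_central G 7 = {\<one>\<^bsub>G\<^esub>}"
    using nilpotency_class_leD[of 6] assms(6) by (simp add: numeral_eq_enat)
  then have triv': "lower_central G (Suc 6) = {\<one>\<^bsub>G\<^esub>}" by simp
  obtain e k where d: "1 \<le> d"
    and exp1: "\<And>a. a \<in> carrier G \<Longrightarrow> a [^]\<^bsub>G\<^esub> (p ^ e) = \<one>\<^bsub>G\<^esub>"
    and expo: "group_exponent (G\<lparr>carrier := lower_central G d\<rparr>) = p ^ e"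
    and k: "k \<in> lower_central G d" "ord k = p ^ e"
    and exp2: "\<And>a. a \<in> lower_central G (Suc d) \<Longrightarrow> a [^]\<^bsub>G\<^esub> (p ^ (e - 1)) = \<one>\<^bsub>G\<^esub>"
    using last_full_exponent_index[OF assms(1,4,5) triv'] unfolding assms(7)[symmetric] by blast
  have pos: "p ^ e > 0" using assms(2) by simp
  have prod: "step_product G x h (p ^ e) = \<one>\<^bsub>G\<^esub>" if "x \<in> carrier G" "h \<in> lower_central G d" for x h
    by (rule step_product_lower_central[OF assms(1,2) triv d exp1 exp2 that])
  have closed: "h \<in> carrier G" if "h \<in> lower_central G d" for h
    by (rule lower_central_closed[OF that d])
  have "J_group G"
  proof (rule J_group_if_step_product_eq_one[OF closed[OF k(1)] pos])
    show "k [^]\<^bsub>G\<^esub> (p ^ e) = \<one>\<^bsub>G\<^esub>" using exp1 closed[OF k(1)] by simp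
    show "p ^ e dvd i" if "k [^]\<^bsub>G\<^esub> i = \<one>\<^bsub>G\<^esub>" for i
      using that closed[OF k(1)] k(2) by (simp add: pow_eq_id)
    show "step_product G x k (p ^ e) = \<one>\<^bsub>G\<^esub>" if "x \<in> carrier G" for x
      by (rule prod[OF that k(1)])
  qed
  moreover have "full_order_elements (G\<lparr>carrier := lower_central G d\<rparr>) \<subseteq> witnesses G"
  proof
    fix h assume "h \<in> full_order_elements (G\<lparr>carrier := lower_central G d\<rparr>)"
    then have h: "h \<in> lower_central G d" and ord: "ord h = p ^ e"
      using expo by (simp_all add: full_order_elements_def ord_subgroup[OF lower_central_subgroup[OF d]])
    show "h \<in> witnesses G"
      unfolding witnesses_def mem_Collect_eq ord
      using closed[OF h] pos by (intro conjI ballI) (simp_all only: foldr_eq_step_product prod[OF _ h])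
  qed
  ultimately show ?thesis ..
qed

end
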